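(* Every locally checkable proof for ELECTION-PREDICTION on arbitrary $n$-node graphs has certificates on $\Omega(n)$ bits, and every locally checkable proof for REACHABILITY on arbitrary $n$-node graphs has certificates on $\Omega(n)$ bits.
   Context: All graphs are finite, simple, undirected and connected; $N(u)$ is the set of neighbors of $u$ and $d(u)=|N(u)|$. A configuration of $G=(V,E)$ is a map $x\in\{0,1\}^V$. Majority dynamics: from $x^0=x$, for every $t\ge 0$ and all nodes $u$ simultaneously, $x_u^{t+1}=1$ if $\sum_{v\in N(u)}x_v^t>d(u)/2$; $x_u^{t+1}=x_u^t$ if $\sum_{v\in N(u)}x_v^t=d(u)/2$; and $x_u^{t+1}=0$ otherwise. ELECTION-PREDICTION is the set of instances $(G,(x,T))$ where $x$ is a configuration of $G$, $T>0$ is an integer, and $\sum_{v\in V(G)}x_v^T>|V(G)|/2$; each node $v$ has input $(x_v,T)$. REACHABILITY is the set of instances $(G,(x,y,T))$ where $x,y$ are configurations of $G$, $T>0$ is an integer, and $x^T=y$; each node $v$ has input $(x_v,y_v,T)$. In both, $T$ is the same at all nodes, and the nodes carry distinct identifiers from $\{1,\dots,n^c\}$, with $c>1$ a fixed constant and $n$ the number of nodes. A locally checkable proof for a distributed language $\mathcal L$ consists of a prover and a verifier. The prover assigns to each node a binary string (certificate), which may depend on the whole instance including identifiers. The verifier has a constant radius $t\ge1$ (depending only on the verifier, not on the instance); each node $v$ sees the subgraph induced by all nodes at distance at most $t$ from $v$, together with their identifiers, inputs and certificates, performs unbounded computation, and accepts or rejects. It must satisfy, for all instances and identifier assignments: (completeness)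 if the instance is in $\mathcal L$, the certificates assigned by the prover make all nodes accept; (soundness) if the instance is not in $\mathcal L$, then for every assignment of certificates at least one node rejects. The certificate size is the function of $n$ giving the maximum number of bits of a certificate assigned by the prover on instances of $\mathcal L$ with $n$ nodes. The $\Omega$-bound is on this function as $n\to\infty$. *)

theory Defs
  imports
    Graph_Theory.Digraph_Component
    Graph_Theory.Pair_Digraph
    Graph_Theory.Arc_Walk
    "HOL-Library.Extended_Nat"
    "HOL-Library.Extended_Real"
    Complex_Main
begin

text \<open>
  A simple undirected graph is a \<open>pair_graph\<close>: finite, loop-free, with a symmetric set of
  ordered pairs as arcs. The library's connectedness includes that there is at least one vertex
  (on the empty graph no node could ever reject). Vertices are anonymous natural numbers, so that
  all orders are available; they are kept apart from the identifiers.
\<close>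

type_synonym ngraph = "nat pair_pre_digraph"

definition simple_connected :: "ngraph \<Rightarrow> bool" where
  "simple_connected G \<longleftrightarrow> pair_graph G \<and> Digraph_Component.connected (with_proj G)"

definition nbrs :: "ngraph \<Rightarrow> nat \<Rightarrow> nat set" where
  "nbrs G u = {v. (u, v) \<in> parcs G}"

definition deg :: "ngraph \<Rightarrow> nat \<Rightarrow> nat" where
  "deg G u = card (nbrs G u)"


text \<open>
  Configurations are Boolean functions (\<open>True\<close> is state 1). They are total on \<open>nat\<close>, but at
  vertices of the graph only the values at vertices of the graph matter.
\<close>

type_synonym config = "nat \<Rightarrow> bool"

definition majority_step :: "ngraph \<Rightarrow> config \<Rightarrow> config" where
  "majority_step G x = (\<lambda>u.
     let s = (\<Sum>v\<in>nbrs G u. of_bool (x v) :: real); h = real (deg G u) / 2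
     in if s > h then True else if s = h then x u else False)"

definition majority_dynamics :: "ngraph \<Rightarrow> config \<Rightarrow> nat \<Rightarrow> config" where
  "majority_dynamics G x t = (majority_step G ^^ t) x"


text \<open>
  An instance is a graph with an input at every node. The set of well-formed instances is needed
  besides the language itself, because soundness only concerns well-formed instances: \<open>T\<close> is
  positive and the same at all nodes.
\<close>

type_synonym 'i inst = "ngraph \<times> (nat \<Rightarrow> 'i)"

definition election_instances :: "(bool \<times> nat) inst set" where
  "election_instances = {(G, \<lambda>v. (x v, T)) | G x T. simple_connected G \<and> T > 0}"

definition ELECTION_PREDICTION :: "(bool \<times> nat) inst set" where
  "ELECTION_PREDICTION = {(G, \<lambda>v. (x v, T)) | G x T. simple_connected G \<and> T > 0 \<and>
     (\<Sum>v\<in>pverts G. of_bool (majority_dynamics G x T v) :: real) > real (card (pverts G)) / 2}"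

definition reachability_instances :: "(bool \<times> bool \<times> nat) inst set" where
  "reachability_instances = {(G, \<lambda>v. (x v, y v, T)) | G x y T. simple_connected G \<and> T > 0}"

definition REACHABILITY :: "(bool \<times> bool \<times> nat) inst set" where
  "REACHABILITY = {(G, \<lambda>v. (x v, y v, T)) | G x y T. simple_connected G \<and> T > 0 \<and>
     (\<forall>v\<in>pverts G. majority_dynamics G x T v = y v)}"


definition id_assignment :: "real \<Rightarrow> ngraph \<Rightarrow> (nat \<Rightarrow> nat) \<Rightarrow> bool" where
  "id_assignment c G ident \<longleftrightarrow> inj_on ident (pverts G) \<and>
     (\<forall>v\<in>pverts G. 1 \<le> ident v \<and> real (ident v) \<le> real (card (pverts G)) powr c)"

definition nbhd :: "ngraph \<Rightarrow> nat \<Rightarrow> nat \<Rightarrow> nat set" where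
  "nbhd G t v = {u. \<exists>p. pre_digraph.awalk (with_proj G) v p u \<and> length p \<le> t}"

text \<open>
  The radius-\<open>t\<close> view of \<open>v\<close>: the identifier of \<open>v\<close>, the subgraph induced by the nodes at
  distance at most \<open>t\<close>, written on identifiers, and the identifier, input and certificate of each
  of these nodes. Neither vertex names nor any data from outside the ball enter the view.
\<close>

type_synonym cert = "bool list"
type_synonym 'i view = "nat \<times> nat pair_pre_digraph \<times> (nat \<times> 'i \<times> cert) set"

definition local_view ::
  "nat \<Rightarrow> ngraph \<Rightarrow> (nat \<Rightarrow> nat) \<Rightarrow> (nat \<Rightarrow> 'i) \<Rightarrow> (nat \<Rightarrow> cert) \<Rightarrow> nat \<Rightarrow> 'i view" where
  "local_view t G ident inp crt v =
     (let B = nbhd G t v in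
       (ident v,
        \<lparr>pverts = ident ` B, parcs = map_prod ident ident ` (parcs G \<inter> B \<times> B)\<rparr>,
        (\<lambda>u. (ident u, inp u, crt u)) ` B))"

type_synonym 'i prover = "ngraph \<Rightarrow> (nat \<Rightarrow> nat) \<Rightarrow> (nat \<Rightarrow> 'i) \<Rightarrow> nat \<Rightarrow> cert"
type_synonym 'i verifier = "'i view \<Rightarrow> bool"

definition locally_checkable_proof ::
  "real \<Rightarrow> 'i inst set \<Rightarrow> 'i inst set \<Rightarrow> 'i prover \<Rightarrow> nat \<Rightarrow> 'i verifier \<Rightarrow> bool" where
  "locally_checkable_proof c I L P t A \<longleftrightarrow>
     1 \<le> t \<and>
     (\<forall>(G, inp)\<in>L. \<forall>ident. id_assignment c G ident \<longrightarrow>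
        (\<forall>v\<in>pverts G. A (local_view t G ident inp (P G ident inp) v))) \<and>
     (\<forall>(G, inp)\<in>I - L. \<forall>ident. id_assignment c G ident \<longrightarrow>
        (\<forall>crt. \<exists>v\<in>pverts G. \<not> A (local_view t G ident inp crt v)))"

text \<open>
  The maximum is taken as a supremum in \<open>enat\<close>: since \<open>T\<close> is not bounded in terms of \<open>n\<close>,
  a prover may use arbitrarily long certificates on instances with \<open>n\<close> nodes.
\<close>

definition certificate_size :: "real \<Rightarrow> 'i inst set \<Rightarrow> 'i prover \<Rightarrow> nat \<Rightarrow> enat" where
  "certificate_size c L P n =
     Sup {enat (length (P G ident inp v)) | G ident inp v.
            (G, inp) \<in> L \<and> card (pverts G) = n \<and> id_assignment c G ident \<and> v \<in> pverts G}"

text \<open>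
  The usual asymptotic lower bound, for functions that may take the value \<open>\<infinity>\<close>.
\<close>

definition bigomega_enat :: "(nat \<Rightarrow> real) \<Rightarrow> (nat \<Rightarrow> enat) set" where
  "bigomega_enat g =
     {f. \<exists>k>0. \<forall>\<^sub>F n in sequentially. ereal (k * g n) \<le> ereal_of_enat (f n)}"

end

theory Submission
  imports Defs
begin

text \<open>
  A fooling set argument with a cut of constant size. For sets \<open>S, S' \<subseteq> {1..m}\<close> with \<open>m\<close> linear in
  the number of nodes, there is a graph whose left part depends only on \<open>S\<close> and whose right part
  depends only on \<open>S'\<close>, joined by a channel of constantly many nodes that is longer than twice the
  radius, such that the dynamics ends in a prescribed configuration, the same for all \<open>S\<close> and
  \<open>S'\<close>, iff \<open>S \<subseteq> S'\<close>. If all certificates are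
  shorter than a small multiple of \<open>m\<close>, two different sets have the same certificates in the
  channel for the instances \<open>(S, S)\<close> and \<open>(S', S')\<close>, and gluing the two certificate
  assignments makes all nodes accept both \<open>(S, S')\<close> and \<open>(S', S)\<close>,
  one of which is not in the language.

  As the cut is small, \<open>S\<close> is sent serially. A wave that runs along a chain of nodes serves as a
  clock. A node connected to one chain turning to 0 and to one turning to 1 emits a pulse at
  exactly the times in \<open>S\<close>; layers of decreasing width carry the pulses to the right, and a detector
  there changes its state forever if a pulse arrives at a time that belongs to an element outside
  \<open>S'\<close>. The numbers of zeros and ones are balanced so that the detector decides the election.
\<close>

section \<open>Views and fooling sets\<close>

text \<open>Views are defined through library walks. Powers of the arc relation forget the arc lists
  and allow induction on the length alone.\<close>

lemma awalk_iff_relpow: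
  assumes "pair_wf_digraph G" "v \<in> pverts G"
  shows "(\<exists>p. pre_digraph.awalk (with_proj G) v p u \<and> length p = k) \<longleftrightarrow> (v, u) \<in> parcs G ^^ k"
  using assms(2)
proof (induction k arbitrary: v)
  interpret pair_wf_digraph G by fact
  case 0
  then show ?case by (auto simp: awalk_Nil_iff)
next
  interpret pair_wf_digraph G by fact
  case (Suc k)
  have "(\<exists>p. awalk v p u \<and> length p = Suc k) \<longleftrightarrow>
      (\<exists>w. (v, w) \<in> parcs G \<and> (\<exists>p. awalk w p u \<and> length p = k))"
  proof safe
    fix p assume "awalk v p u" "length p = Suc k"
    then show "\<exists>w. (v, w) \<in> parcs G \<and> (\<exists>p. awalk w p u \<and> length p = k)"
      by (cases p) (force simp: awalk_Cons_iff)+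
  next
    fix w p assume "(v, w) \<in> parcs G" "awalk w p u" "k = length p"
    then have "awalk v ((v, w) # p) u" by (auto simp: awalk_Cons_iff)
    then show "\<exists>q. awalk v q u \<and> length q = Suc (length p)" by (intro exI[of _ "(v, w) # p"]) simp
  qed
  also have "\<dots> \<longleftrightarrow> (\<exists>w. (v, w) \<in> parcs G \<and> (w, u) \<in> parcs G ^^ k)"
    using Suc.IH in_arcsD2 by blast
  also have "\<dots> \<longleftrightarrow> (v, u) \<in> parcs G ^^ Suc k"
    by (meson relpow_Suc_D2 relpow_Suc_I2)
  finally show ?case .
qed

lemma nbhd_relpow:
  assumes "pair_wf_digraph G" "v \<in> pverts G"
  shows "nbhd G t v = {u. \<exists>k\<le>t. (v, u) \<in> parcs G ^^ k}"
  by (simp add: nbhd_def awalk_iff_relpow[OF assms, symmetric]) metis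

text \<open>Every prefix of a short walk is short as well, so all vertices on the way lie in the
  ball, hence in \<open>U\<close>, and each arc survives in \<open>R'\<close>.\<close>

lemma relpow_mono_ball:
  assumes "k \<le> t" "(v, u) \<in> R ^^ k" "{u. \<exists>k\<le>t. (v, u) \<in> R ^^ k} \<subseteq> U" "R \<inter> U \<times> U \<subseteq> R'"
  shows "(v, u) \<in> R' ^^ k"
  using assms(1,2)
proof (induction k arbitrary: u)
  case 0
  then show ?case by simp
next
  case (Suc k)
  from Suc.prems(2) obtain w where w: "(v, w) \<in> R ^^ k" "(w, u) \<in> R" by (rule relpow_Suc_E)
  have k: "k \<le> t" using Suc.prems(1) by simp
  have "w \<in> U" using assms(3) w(1) k by (auto simp only: subset_iff mem_Collect_eq)
  moreover have "u \<in> U" using assms(3) Suc.prems by (auto simp only: subset_iff mem_Collect_eq)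
  ultimately have "(w, u) \<in> R'" using w(2) assms(4) by blast
  with Suc.IH[OF k w(1)] show ?case by (rule relpow_Suc_I)
qed
lemma nbhd_mono:
  assumes "pair_wf_digraph G" "pair_wf_digraph G'" "v \<in> pverts G" "v \<in> pverts G'"
    and sub: "nbhd G t v \<subseteq> U" and agree: "parcs G \<inter> U \<times> U \<subseteq> parcs G'"
  shows "nbhd G t v \<subseteq> nbhd G' t v"
proof
  fix u assume "u \<in> nbhd G t v"
  then obtain k where k: "k \<le> t" "(v, u) \<in> parcs G ^^ k"
    using nbhd_relpow[OF assms(1,3)] by auto
  show "u \<in> nbhd G' t v"
    using relpow_mono_ball[OF k sub[unfolded nbhd_relpow[OF assms(1,3)]] agree] k(1)
      nbhd_relpow[OF assms(2,4)] by auto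
qed

text \<open>\<open>U\<close> is a region on which both graphs have the same arcs. That the two balls
  coincide is not assumed: each contains the other, because walks inside \<open>U\<close> exist in
  both graphs.\<close>

lemma local_view_cong:
  assumes "pair_wf_digraph G" "pair_wf_digraph G'" "v \<in> pverts G" "v \<in> pverts G'"
    and "nbhd G t v \<subseteq> U" "nbhd G' t v \<subseteq> U"
    and arcs: "parcs G \<inter> U \<times> U = parcs G' \<inter> U \<times> U"
    and crt: "\<And>u. u \<in> nbhd G t v \<Longrightarrow> crt u = crt' u"
  shows "local_view t G ident inp crt v = local_view t G' ident inp crt' v"
proof -
  have B: "nbhd G t v = nbhd G' t v"
  proof
    have "parcs G \<inter> U \<times> U \<subseteq> parcs G'" "parcs G' \<inter> U \<times> U \<subseteq> parcs G"
      using arcs by blast+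
    then show "nbhd G t v \<subseteq> nbhd G' t v" "nbhd G' t v \<subseteq> nbhd G t v"
      using nbhd_mono[OF assms(1-5)] nbhd_mono[OF assms(2,1,4,3,6)] by blast+
  qed
  have "parcs G \<inter> nbhd G t v \<times> nbhd G t v = parcs G' \<inter> nbhd G t v \<times> nbhd G t v"
    using arcs assms(5) by blast
  moreover have "(\<lambda>u. (ident u, inp u, crt u)) ` nbhd G t v
      = (\<lambda>u. (ident u, inp u, crt' u)) ` nbhd G t v"
    using crt by (intro image_cong) auto
  ultimately show ?thesis
    unfolding local_view_def Let_def B by simp
qed

lemma nbhd_subset_verts:
  assumes "pair_wf_digraph G"
  shows "nbhd G t v \<subseteq> pverts G"
proof -
  interpret pair_wf_digraph G by fact
  show ?thesis unfolding nbhd_def using awalk_last_in_verts by auto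
qed

lemma nbhd_pos_bound:
  fixes pos :: "nat \<Rightarrow> nat"
  assumes "pair_wf_digraph G" "v \<in> pverts G"
    and step: "\<And>u w. (u, w) \<in> parcs G \<Longrightarrow> pos w \<le> pos u + 1 \<and> pos u \<le> pos w + 1"
    and "u \<in> nbhd G t v"
  shows "pos u \<le> pos v + t \<and> pos v \<le> pos u + t"
proof -
  have "pos u \<le> pos v + k \<and> pos v \<le> pos u + k" if "(v, u) \<in> parcs G ^^ k" for k u
    using that
  proof (induction k arbitrary: u)
    case (Suc k)
    then obtain w where "(v, w) \<in> parcs G ^^ k" "(w, u) \<in> parcs G" by auto
    then show ?case using Suc.IH[of w] step[of w u] by linarith
  qed simp
  moreover obtain k where "k \<le> t" "(v, u) \<in> parcs G ^^ k"
    using assms(4) unfolding nbhd_relpow[OF assms(1,2)] by blast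
  ultimately show ?thesis by (meson add_left_mono le_trans)
qed

lemma card_bool_lists_le: "card {xs :: bool list. length xs \<le> l} \<le> 2 ^ Suc l"
proof -
  have "card {xs. set xs \<subseteq> (UNIV :: bool set) \<and> length xs \<le> l} = (\<Sum>i\<le>l. 2 ^ i)"
    by (subst card_lists_length_le) auto
  also have "\<dots> \<le> 2 ^ Suc l"
    by (induction l) auto
  finally show ?thesis by simp
qed

text \<open>
  \<open>pos\<close> is a coordinate along the cut: \<open>0\<close> is Alice's part, and everything beyond \<open>2 * t + 1\<close> is
  Bob's part. Only the certificates strictly between the two parts are pigeonholed, because no view
  reaches from one part to the other.
\<close>

lemma fooling_set_bound:
  fixes G :: "'w \<Rightarrow> 'w \<Rightarrow> ngraph" and pos :: "nat \<Rightarrow> nat"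
  assumes lcp: "locally_checkable_proof c I L P t A"
    and wf: "\<And>a b. a \<in> W \<Longrightarrow> b \<in> W \<Longrightarrow> pair_wf_digraph (G a b)"
    and verts: "\<And>a b. a \<in> W \<Longrightarrow> b \<in> W \<Longrightarrow> pverts (G a b) = V"
    and "finite V" "finite W"
    and ident: "\<And>a b. a \<in> W \<Longrightarrow> b \<in> W \<Longrightarrow> id_assignment c (G a b) ident"
    and inst: "\<And>a b. a \<in> W \<Longrightarrow> b \<in> W \<Longrightarrow> (G a b, inp) \<in> I"
    and yes: "\<And>a. a \<in> W \<Longrightarrow> (G a a, inp) \<in> L"
    and no: "\<And>a b. a \<in> W \<Longrightarrow> b \<in> W \<Longrightarrow> a \<noteq> b \<Longrightarrow> (G a b, inp) \<notin> L \<or> (G b a, inp) \<notin> L"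
    and step: "\<And>a b u v. a \<in> W \<Longrightarrow> b \<in> W \<Longrightarrow> (u, v) \<in> parcs (G a b) \<Longrightarrow>
        pos v \<le> pos u + 1 \<and> pos u \<le> pos v + 1"
    and left: "\<And>a b u v. a \<in> W \<Longrightarrow> b \<in> W \<Longrightarrow> pos u \<le> 2 * t + 1 \<Longrightarrow> pos v \<le> 2 * t + 1 \<Longrightarrow>
        (u, v) \<in> parcs (G a b) \<longleftrightarrow> (u, v) \<in> parcs (G a a)"
    and right: "\<And>a b u v. a \<in> W \<Longrightarrow> b \<in> W \<Longrightarrow> 1 \<le> pos u \<Longrightarrow> 1 \<le> pos v \<Longrightarrow>
        (u, v) \<in> parcs (G a b) \<longleftrightarrow> (u, v) \<in> parcs (G b b)"
    and len: "\<And>a v. a \<in> W \<Longrightarrow> v \<in> V \<Longrightarrow> length (P (G a a) ident inp v) \<le> l"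
  shows "card W \<le> (2 ^ Suc l) ^ card {v \<in> V. 1 \<le> pos v \<and> pos v \<le> 2 * t + 1}"
proof (rule ccontr)
  define Mid where "Mid = {v \<in> V. 1 \<le> pos v \<and> pos v \<le> 2 * t + 1}"
  \<comment> \<open>\<open>restrict\<close> fixes the value outside \<open>Mid\<close>, so
    \<open>f\<close> maps into a finite function space and a collision means agreement on
    \<open>Mid\<close>.\<close>
  define f where "f a = restrict (P (G a a) ident inp) Mid" for a
  assume "\<not> ?thesis"
  then have big: "(2 ^ Suc l) ^ card Mid < card W" by (simp add: Mid_def)
  have finMid: "finite Mid" using \<open>finite V\<close> by (simp add: Mid_def)
  have finlists: "finite {xs :: bool list. length xs \<le> l}"
    using finite_lists_length_le[of "UNIV :: bool set" l] by simp
  have "f ` W \<subseteq> Mid \<rightarrow>\<^sub>E {xs. length xs \<le> l}"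
    using len by (intro image_subsetI PiE_I) (simp_all add: f_def, simp add: Mid_def)
  then have "card (f ` W) \<le> card (Mid \<rightarrow>\<^sub>E {xs :: bool list. length xs \<le> l})"
    using finMid finlists by (intro card_mono finite_PiE) auto
  also have "\<dots> = card {xs :: bool list. length xs \<le> l} ^ card Mid"
    using finMid by (simp add: card_PiE)
  also have "\<dots> \<le> (2 ^ Suc l) ^ card Mid"
    by (intro power_mono card_bool_lists_le) simp
  finally have "\<not> inj_on f W" using big pigeonhole[of f W] by linarith
  then obtain a b where ab: "a \<in> W" "b \<in> W" "a \<noteq> b" "f a = f b"
    by (auto simp: inj_on_def)
  have mixed: "(G a b, inp) \<in> L" if ab: "a \<in> W" "b \<in> W" "f a = f b" for a b
  proof (rule ccontr)
    assume "(G a b, inp) \<notin> L"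
    define crt where "crt v = (if pos v \<le> 2 * t + 1 then P (G a a) ident inp v
        else P (G b b) ident inp v)" for v
    have mid: "P (G a a) ident inp v = P (G b b) ident inp v" if "v \<in> Mid" for v
      using fun_cong[OF ab(3), of v] that by (simp add: f_def)
    have acc: "A (local_view t (G w w) ident inp (P (G w w) ident inp) v)"
      if "w \<in> W" "v \<in> V" for v w
    proof -
      have "\<forall>v\<in>pverts (G w w). A (local_view t (G w w) ident inp (P (G w w) ident inp) v)"
        using conjunct1[OF conjunct2[OF lcp[unfolded locally_checkable_proof_def]]]
          yes[OF that(1)] ident[OF that(1,1)] by blast
      then show ?thesis using that verts[OF that(1,1)] by simp
    qed
    obtain v where v: "v \<in> V" "\<not> A (local_view t (G a b) ident inp crt v)"
    proof -
      have "\<exists>v\<in>pverts (G a b). \<not> A (local_view t (G a b) ident inp crt v)"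
        using conjunct2[OF conjunct2[OF lcp[unfolded locally_checkable_proof_def]]]
          inst[OF ab(1,2)] ident[OF ab(1,2)] \<open>(G a b, inp) \<notin> L\<close> by blast
      then show ?thesis using that verts[OF ab(1,2)] by auto
    qed
    have near: "pos u \<le> pos v + t \<and> pos v \<le> pos u + t \<and> u \<in> V"
      if "u \<in> nbhd (G x y) t v" "x \<in> W" "y \<in> W" for u x y
    proof -
      note G = wf[OF that(2,3)] verts[OF that(2,3)]
      have "u \<in> V" using nbhd_subset_verts[OF G(1)] that(1) G(2) by blast
      moreover have "pos u \<le> pos v + t \<and> pos v \<le> pos u + t"
        by (rule nbhd_pos_bound[OF G(1) _ step[OF that(2,3)] that(1)]) (use v(1) G(2) in simp_all)
      ultimately show ?thesis by blast
    qed
    show False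
    \<comment> \<open>A view centred at position at most \<open>t\<close> ends at position
      \<open>2 * t\<close> or before, where the glued assignment is that of \<open>(a, a)\<close>.
      Any other view starts at position 1 or later, where it is that of \<open>(b, b)\<close>,
      because both assignments agree on \<open>Mid\<close>.\<close>
    proof (cases "pos v \<le> t")
      case True
      have "local_view t (G a b) ident inp crt v
          = local_view t (G a a) ident inp (P (G a a) ident inp) v"
      proof (rule local_view_cong[where U = "{u. pos u \<le> 2 * t + 1}"])
        show "parcs (G a b) \<inter> {u. pos u \<le> 2 * t + 1} \<times> {u. pos u \<le> 2 * t + 1} =
            parcs (G a a) \<inter> {u. pos u \<le> 2 * t + 1} \<times> {u. pos u \<le> 2 * t + 1}"
          using left[OF ab(1,2)] by blast
        show "crt u = P (G a a) ident inp u" if "u \<in> nbhd (G a b) t v" for u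
          using near[OF that ab(1,2)] True by (simp add: crt_def)
        show "nbhd (G a b) t v \<subseteq> {u. pos u \<le> 2 * t + 1}" using near[OF _ ab(1,2)] True by fastforce
        show "nbhd (G a a) t v \<subseteq> {u. pos u \<le> 2 * t + 1}" using near[OF _ ab(1,1)] True by force
      qed (simp_all add: wf verts ab v(1))
      then show False using acc[OF ab(1) v(1)] v(2) by simp
    next
      case False
      have "local_view t (G a b) ident inp crt v
          = local_view t (G b b) ident inp (P (G b b) ident inp) v"
      proof (rule local_view_cong[where U = "{u. 1 \<le> pos u}"])
        show "parcs (G a b) \<inter> {u. 1 \<le> pos u} \<times> {u. 1 \<le> pos u} =
            parcs (G b b) \<inter> {u. 1 \<le> pos u} \<times> {u. 1 \<le> pos u}"
          using right[OF ab(1,2)] by blast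
        show "crt u = P (G b b) ident inp u" if "u \<in> nbhd (G a b) t v" for u
        proof -
          have "1 \<le> pos u" "u \<in> V" using near[OF that ab(1,2)] False by linarith+
          then show ?thesis using mid[of u] by (simp add: crt_def Mid_def)
        qed
        show "nbhd (G a b) t v \<subseteq> {u. 1 \<le> pos u}" using near[OF _ ab(1,2)] False by force
        show "nbhd (G b b) t v \<subseteq> {u. 1 \<le> pos u}" using near[OF _ ab(2,2)] False by force
      qed (simp_all add: wf verts ab v(1))
      then show False using acc[OF ab(2) v(1)] v(2) by simp
    qed
  qed
  show False using no[OF ab(1-3)] mixed[OF ab(1,2,4)] mixed[OF ab(2,1) ab(4)[symmetric]] by blast
qed

section \<open>Clocks, channel and detector\<close>

text \<open>
  \<open>Clock \<sigma> s i \<kappa>\<close> is copy \<open>\<kappa>\<close> of level \<open>i\<close> of the clock on side \<open>\<sigma>\<close> (\<open>False\<close> is Alice, \<open>True\<close> is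
  Bob) that turns level by level to the state \<open>s\<close>. \<open>Layer j \<kappa>\<close> is copy \<open>\<kappa>\<close> of layer \<open>j\<close> of the channel
  from Alice to Bob; layer \<open>r + 1\<close> is the detector.
\<close>

datatype node = Clock bool bool nat nat | Layer nat nat

text \<open>\<open>K_large\<close> makes level 0 constant: besides its
  \<open>K \<sigma> s - 1\<close> clique neighbours, such a node sees at most \<open>M * B\<close>
  nodes of higher levels, one node of the opposite clique and \<open>B\<close> nodes of a
  layer.\<close>

locale clock_network =
  fixes r M :: nat and K :: "bool \<Rightarrow> bool \<Rightarrow> nat"
  assumes r_pos: "1 \<le> r" and M_ge: "2 \<le> M"
    and K_large: "\<And>\<sigma> s. 2 + Suc M * (3 * r + 2) < K \<sigma> s"
begin

abbreviation B :: nat where "B \<equiv> 3 * r + 2"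

text \<open>
  A channel node below the detector sees more nodes in the previous layer than in the next one, so
  that information flows forwards only.
\<close>

definition width :: "nat \<Rightarrow> nat" where
  "width j = (if j \<le> r then 3 * (r - j) + 1 else 3)"

fun is_node :: "node \<Rightarrow> bool" where
  "is_node (Clock \<sigma> s i \<kappa>) \<longleftrightarrow> (if i = 0 then \<kappa> < K \<sigma> s else i \<le> M \<and> \<kappa> < B)"
| "is_node (Layer j \<kappa>) \<longleftrightarrow> j \<le> Suc r \<and> \<kappa> < width j"

definition nodes :: "node set" where "nodes = {v. is_node v}"

text \<open>A tap of Alice has to outweigh the whole of layer 1, while a tap of Bob must weigh
  exactly as much as the single node of layer \<open>r\<close>.\<close>

definition fan :: "bool \<Rightarrow> nat" where "fan \<sigma> = (if \<sigma> then 1 else B)"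

text \<open>Level 0 supplies constant votes: ones for Alice's source, and one vote of each kind for
  every detector node.\<close>

definition taps :: "(bool \<Rightarrow> nat set) \<Rightarrow> bool \<Rightarrow> bool \<Rightarrow> nat set" where
  "taps X \<sigma> s = (if s then Suc ` X \<sigma> else X \<sigma>) \<union> (if s \<or> \<sigma> then {0} else {})"

text \<open>
  Level 0 of a clock is a clique too large to ever change. Its first \<open>B\<close> copies drive level 1; the
  next \<open>B\<close> copies bias all levels but the last one towards \<open>s\<close>, so that a level turns as soon as
  its predecessor has turned, and not before. The remaining copies only adjust the number of nodes.

  Tapping the \<open>False\<close> clock at level \<open>i\<close> and the \<open>True\<close> clock at level \<open>i + 1\<close> takes one vote away
  from the tapping node at time \<open>i\<close> only.
\<close>

fun link :: "(bool \<Rightarrow> nat set) \<Rightarrow> node \<Rightarrow> node \<Rightarrow> bool" where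
  "link X (Clock \<sigma> s i \<kappa>) (Clock \<sigma>' s' i' \<kappa>') \<longleftrightarrow> \<sigma> = \<sigma>' \<and>
     (if s = s'
      then (i = 0 \<and> i' = 0 \<and> \<kappa> \<noteq> \<kappa>') \<or> (i' = Suc i \<and> \<kappa> < B)
         \<or> (i = 0 \<and> B \<le> \<kappa> \<and> \<kappa> < 2 * B \<and> 1 \<le> i' \<and> i' < M)
      else i = 0 \<and> i' = 0 \<and> \<kappa> = \<kappa>')"
| "link X (Clock \<sigma> s i \<kappa>) (Layer j \<kappa>') \<longleftrightarrow>
     i \<in> taps X \<sigma> s \<and> \<kappa> < fan \<sigma> \<and> j = (if \<sigma> then Suc r else 0)"
| "link X (Layer j \<kappa>) (Layer j' \<kappa>') \<longleftrightarrow> j' = Suc j \<or> (j = Suc r \<and> j' = Suc r \<and> \<kappa> \<noteq> \<kappa>')"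
| "link X (Layer j \<kappa>) (Clock \<sigma> s i \<kappa>') \<longleftrightarrow> False"

definition adj :: "(bool \<Rightarrow> nat set) \<Rightarrow> node \<Rightarrow> node \<Rightarrow> bool" where
  "adj X u v \<longleftrightarrow> is_node u \<and> is_node v \<and> (link X u v \<or> link X v u)"

definition Nb :: "(bool \<Rightarrow> nat set) \<Rightarrow> node \<Rightarrow> node set" where
  "Nb X u = {v. adj X u v}"

definition admissible :: "(bool \<Rightarrow> nat set) \<Rightarrow> bool" where
  "admissible X \<longleftrightarrow> (\<forall>\<sigma>. X \<sigma> \<subseteq> {i. 1 \<le> i \<and> Suc i < M})"

lemma admissibleD:
  assumes "admissible X" "i \<in> X \<sigma>"
  shows "1 \<le> i" "Suc i < M" "i \<noteq> 0"
proof -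
  have "i \<in> {i. 1 \<le> i \<and> Suc i < M}" using assms unfolding admissible_def by blast
  then show "1 \<le> i" "Suc i < M" "i \<noteq> 0" by auto
qed

text \<open>
  The detector is a triangle. Against its other two nodes, neither a pulse of the channel nor one of
  Bob's clock suffices to flip a detector node, but two simultaneous pulses flip it for good.
\<close>

definition alarm :: "(bool \<Rightarrow> nat set) \<Rightarrow> nat \<Rightarrow> bool" where
  "alarm X t \<longleftrightarrow> (\<exists>t'<t. t' \<in> X True \<and> r < t' \<and> t' - Suc r \<in> X False)"

text \<open>The whole trajectory in closed form. The pulse for \<open>i\<close> is a 0 in layer
  \<open>j\<close> exactly at time \<open>i + j + 1\<close>; the guard \<open>j < t\<close> makes
  the truncated subtraction exact.\<close>

fun cfg :: "(bool \<Rightarrow> nat set) \<Rightarrow> nat \<Rightarrow> node \<Rightarrow> bool" where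
  "cfg X t (Clock \<sigma> s i \<kappa>) = (if i \<le> t then s else \<not> s)"
| "cfg X t (Layer j \<kappa>) =
     (if j \<le> r then \<not> (j < t \<and> t - Suc j \<in> X False) else \<not> alarm X t)"

section \<open>Sizes and finiteness of the node set\<close>

lemma width_le: "j \<le> Suc r \<Longrightarrow> width j < B"
  using r_pos by (auto simp: width_def)

lemma K_ge: "2 * B < K \<sigma> s"
proof -
  have "2 * B \<le> Suc M * B" using M_ge by (intro mult_right_mono) auto
  then show ?thesis using K_large[of \<sigma> s] by linarith
qed

lemma K_gt: "\<kappa> < 2 * B \<Longrightarrow> \<kappa> < K \<sigma> s"
  using K_ge[of \<sigma> s] by linarith

lemma nodes_eq: "nodes =
   (\<Union>\<sigma>. \<Union>s. Clock \<sigma> s 0 ` {..<K \<sigma> s}) \<union>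
   (\<lambda>(\<sigma>, s, i, \<kappa>). Clock \<sigma> s i \<kappa>) ` (UNIV \<times> UNIV \<times> {1..M} \<times> {..<B}) \<union>
   (\<lambda>(j, \<kappa>). Layer j \<kappa>) ` (SIGMA j:{..Suc r}. {..<width j})"
  (is "_ = ?A \<union> ?C \<union> ?L")
proof
  show "nodes \<subseteq> ?A \<union> ?C \<union> ?L"
  proof
    fix v assume "v \<in> nodes"
    then have v: "is_node v" by (simp add: nodes_def)
    show "v \<in> ?A \<union> ?C \<union> ?L"
    proof (cases v)
      case (Clock \<sigma> s i \<kappa>)
      show ?thesis
      proof (cases "i = 0")
        case True
        then show ?thesis using v Clock by auto
      next
        case False
        then have "v \<in> ?C"
          using v Clock by (intro image_eqI[of _ _ "(\<sigma>, s, i, \<kappa>)"]) auto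
        then show ?thesis by blast
      qed
    next
      case (Layer j \<kappa>)
      then have "v \<in> ?L" using v by (intro image_eqI[of _ _ "(j, \<kappa>)"]) auto
      then show ?thesis by blast
    qed
  qed
  show "?A \<union> ?C \<union> ?L \<subseteq> nodes" by (auto simp: nodes_def)
qed

lemma finite_nodes: "finite nodes"
  unfolding nodes_eq by auto

lemma Nb_subset: "Nb X u \<subseteq> nodes"
  by (auto simp: Nb_def adj_def nodes_def)

lemma finite_Nb: "finite (Nb X u)"
  using finite_nodes Nb_subset by (rule rev_finite_subset)

section \<open>Strict majorities in cliques, clock levels and channel layers\<close>

definition forced :: "(bool \<Rightarrow> nat set) \<Rightarrow> (node \<Rightarrow> bool) \<Rightarrow> node \<Rightarrow> bool \<Rightarrow> bool" where
  "forced X x u b \<longleftrightarrow> (\<exists>C \<subseteq> Nb X u. (\<forall>v\<in>C. x v = b) \<and> card (Nb X u) < 2 * card C)"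

text \<open>With a witness set, a lower bound on the agreeing neighbours and an upper bound
  \<open>D\<close> on the neighbourhood suffice. The majority being strict, the tie rule of the
  dynamics never has to be consulted.\<close>

lemma forcedI:
  assumes "C \<subseteq> Nb X u" "\<And>v. v \<in> C \<Longrightarrow> x v = b" "Nb X u \<subseteq> D" "finite D" "card D < 2 * card C"
  shows "forced X x u b"
proof -
  have "card (Nb X u) \<le> card D" using assms by (intro card_mono)
  then show ?thesis using assms unfolding forced_def by (intro exI[of _ C]) auto
qed

lemma card_Clock [simp]: "card (Clock \<sigma> s i ` A) = card A"
  and card_Layer [simp]: "card (Layer j ` A) = card A"
  by (auto intro!: card_image inj_onI)

lemma card_Un4_le: "card (P \<union> Q \<union> R \<union> S) \<le> card P + card Q + card R + card S"
  using card_Un_le[of "P \<union> Q \<union> R" S] card_Un_le[of "P \<union> Q" R] card_Un_le[of P Q] by linarith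

abbreviation target :: "bool \<Rightarrow> nat" where "target \<sigma> \<equiv> (if \<sigma> then Suc r else 0)"

lemma forced_clique:
  assumes "admissible X" "\<kappa> < K \<sigma> s"
  shows "forced X (cfg X t) (Clock \<sigma> s 0 \<kappa>) s"
proof (rule forcedI)
  let ?C = "Clock \<sigma> s 0 ` ({..<K \<sigma> s} - {\<kappa>})"
  let ?D = "?C \<union> {Clock \<sigma> (\<not> s) 0 \<kappa>} \<union> (\<lambda>(i, \<kappa>). Clock \<sigma> s i \<kappa>) ` ({1..M} \<times> {..<B})
     \<union> Layer (target \<sigma>) ` {..<B}"
  show "?C \<subseteq> Nb X (Clock \<sigma> s 0 \<kappa>)" using assms by (auto simp: Nb_def adj_def)
  show "Nb X (Clock \<sigma> s 0 \<kappa>) \<subseteq> ?D"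
  proof
    fix v assume "v \<in> Nb X (Clock \<sigma> s 0 \<kappa>)"
    then have v: "adj X (Clock \<sigma> s 0 \<kappa>) v" by (simp add: Nb_def)
    show "v \<in> ?D"
    proof (cases v)
      case (Clock \<sigma>' s' i \<kappa>')
      show ?thesis
      proof (cases "i = 0")
        case True
        then show ?thesis using v Clock by (auto simp: adj_def split: if_splits)
      next
        case False
        then have "v \<in> (\<lambda>(i, \<kappa>). Clock \<sigma> s i \<kappa>) ` ({1..M} \<times> {..<B})"
          using v Clock by (intro image_eqI[of _ _ "(i, \<kappa>')"]) (auto simp: adj_def split: if_splits)
        then show ?thesis by blast
      qed
    next
      case (Layer j \<kappa>')
      then have "j = target \<sigma>" "\<kappa>' < B"
        using v width_le[of j] by (auto simp: adj_def split: if_splits)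
      then show ?thesis using Layer by auto
    qed
  qed
  have "card ?C = K \<sigma> s - 1" using assms(2) by simp
  moreover have "card ((\<lambda>(i, \<kappa>). Clock \<sigma> s i \<kappa>) ` ({1..M} \<times> {..<B})) \<le> M * B"
    by (rule order_trans[OF card_image_le]) auto
  moreover note card_Un4_le[of ?C "{Clock \<sigma> (\<not> s) 0 \<kappa>}"
      "(\<lambda>(i, \<kappa>). Clock \<sigma> s i \<kappa>) ` ({1..M} \<times> {..<B})" "Layer (target \<sigma>) ` {..<B}"]
  moreover have "card (Layer (target \<sigma>) ` {..<B}) = B" by simp
  moreover have "card {Clock \<sigma> (\<not> s) 0 \<kappa>} = 1" by simp
  moreover have "2 + (M * B + B) < K \<sigma> s" using K_large[of \<sigma> s] by (simp add: algebra_simps)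
  ultimately show "card ?D < 2 * card ?C" by linarith
qed auto

text \<open>The last level is never tapped, so its only neighbours are those in the level before
  it.\<close>

lemma tap_bounds:
  assumes "admissible X" "i \<in> taps X \<sigma> s"
  shows "i < M"
  using assms(2) M_ge
  by (auto simp: taps_def split: if_splits dest!: admissibleD(2)[OF assms(1)])

lemma fan_le: "fan \<sigma> \<le> B"
  by (simp add: fan_def)

text \<open>Below the last level there are fewer than \<open>4 * B\<close> neighbours: three blocks
  of size \<open>B\<close> (predecessor, bias, successor) and part of a layer. Any two agreeing
  blocks win. They are predecessor and bias once the predecessor has turned, and predecessor and
  successor before that.\<close>

lemma forced_clock:
  assumes "admissible X" "1 \<le> i" "i \<le> M" "\<kappa> < B"
  shows "forced X (cfg X t) (Clock \<sigma> s i \<kappa>) (cfg X (Suc t) (Clock \<sigma> s i \<kappa>))"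
proof (cases "i = M")
  case True
  show ?thesis
  proof (rule forcedI)
    let ?C = "Clock \<sigma> s (i - 1) ` {..<B}"
    show "?C \<subseteq> Nb X (Clock \<sigma> s i \<kappa>)"
      using assms K_gt by (auto simp: Nb_def adj_def)
    show "Nb X (Clock \<sigma> s i \<kappa>) \<subseteq> ?C"
    proof
      fix v assume "v \<in> Nb X (Clock \<sigma> s i \<kappa>)"
      then have v: "adj X (Clock \<sigma> s i \<kappa>) v" by (simp add: Nb_def)
      show "v \<in> ?C"
        using v tap_bounds[OF assms(1), of i \<sigma> s] assms(2) True
        by (cases v) (auto simp: adj_def split: if_splits)
    qed
    show "card ?C < 2 * card ?C" by simp
  qed (use assms in auto)
next
  case False
  then have i: "i < M" using assms by simp
  let ?P = "Clock \<sigma> s (i - 1) ` {..<B}"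
  let ?H = "Clock \<sigma> s 0 ` {B..<2 * B}"
  let ?Q = "Clock \<sigma> s (Suc i) ` {..<B}"
  let ?L = "Layer (target \<sigma>) ` {..<width (target \<sigma>)}"
  have sub: "Nb X (Clock \<sigma> s i \<kappa>) \<subseteq> ?P \<union> ?H \<union> ?Q \<union> ?L"
  proof
    fix v assume "v \<in> Nb X (Clock \<sigma> s i \<kappa>)"
    then have v: "adj X (Clock \<sigma> s i \<kappa>) v" by (simp add: Nb_def)
    show "v \<in> ?P \<union> ?H \<union> ?Q \<union> ?L"
      using v assms(2) i by (cases v) (auto simp: adj_def split: if_splits)
  qed
  have "card (?P \<union> ?H \<union> ?Q \<union> ?L) \<le> card ?P + card ?H + card ?Q + card ?L"
    by (rule card_Un4_le)
  also have "\<dots> < 4 * B" using width_le[of "target \<sigma>"] by simp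
  finally have less: "card (?P \<union> ?H \<union> ?Q \<union> ?L) < 4 * B" .
  have P: "?P \<subseteq> Nb X (Clock \<sigma> s i \<kappa>)"
    using assms K_gt by (auto simp: Nb_def adj_def)
  have H: "?H \<subseteq> Nb X (Clock \<sigma> s i \<kappa>)"
    using assms K_gt i by (auto simp: Nb_def adj_def)
  have Q: "?Q \<subseteq> Nb X (Clock \<sigma> s i \<kappa>)"
    using assms K_gt i by (auto simp: Nb_def adj_def)
  show ?thesis
  proof (cases "i \<le> Suc t")
    case True
    have "?P \<inter> ?H = {}" by auto
    then have card: "card (?P \<union> ?H) = 2 * B" by (simp add: card_Un_disjoint)
    show ?thesis
    proof (rule forcedI[OF _ _ sub])
      show "?P \<union> ?H \<subseteq> Nb X (Clock \<sigma> s i \<kappa>)" using P H by blast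
      show "cfg X t v = cfg X (Suc t) (Clock \<sigma> s i \<kappa>)" if "v \<in> ?P \<union> ?H" for v
        using that True by auto
      show "card (?P \<union> ?H \<union> ?Q \<union> ?L) < 2 * card (?P \<union> ?H)" using card less by linarith
    qed simp
  next
    case False
    have "?P \<inter> ?Q = {}" by auto
    then have card: "card (?P \<union> ?Q) = 2 * B" by (simp add: card_Un_disjoint)
    show ?thesis
    proof (rule forcedI[OF _ _ sub])
      show "?P \<union> ?Q \<subseteq> Nb X (Clock \<sigma> s i \<kappa>)" using P Q by blast
      show "cfg X t v = cfg X (Suc t) (Clock \<sigma> s i \<kappa>)" if "v \<in> ?P \<union> ?Q" for v
      proof -
        have "\<not> i - 1 \<le> t" "\<not> Suc i \<le> t" using False by auto
        then show ?thesis using that False by (auto simp del: One_nat_def)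
      qed
      show "card (?P \<union> ?H \<union> ?Q \<union> ?L) < 2 * card (?P \<union> ?Q)" using card less by linarith
    qed simp
  qed
qed

text \<open>The critical case is \<open>j = r\<close>, where the four nodes of layer
  \<open>r - 1\<close> face the three detector nodes; this is why the widths grow by three.\<close>

lemma width_step: "1 \<le> j \<Longrightarrow> j \<le> r \<Longrightarrow> width (Suc j) < width (j - 1)"
  by (auto simp: width_def)

lemma forced_layer:
  assumes "1 \<le> j" "j \<le> r" "\<kappa> < width j"
  shows "forced X (cfg X t) (Layer j \<kappa>) (cfg X (Suc t) (Layer j \<kappa>))"
proof (rule forcedI)
  let ?C = "Layer (j - 1) ` {..<width (j - 1)}"
  let ?D = "?C \<union> Layer (Suc j) ` {..<width (Suc j)}"
  show "?C \<subseteq> Nb X (Layer j \<kappa>)"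
    using assms by (auto simp: Nb_def adj_def)
  show "Nb X (Layer j \<kappa>) \<subseteq> ?D"
  proof
    fix v assume "v \<in> Nb X (Layer j \<kappa>)"
    then have v: "adj X (Layer j \<kappa>) v" by (simp add: Nb_def)
    show "v \<in> ?D" using v assms by (cases v) (auto simp: adj_def split: if_splits)
  qed
  show "card ?D < 2 * card ?C"
    using card_Un_le[of ?C "Layer (Suc j) ` {..<width (Suc j)}"] width_step[OF assms(1,2)] by simp
  show "cfg X t v = cfg X (Suc t) (Layer j \<kappa>)" if "v \<in> ?C" for v
  proof -
    obtain i where i: "j = Suc i" using assms(1) by (cases j) auto
    then show ?thesis using that assms(2) by auto
  qed
qed auto

section \<open>Votes of the tapped clock nodes at a given time\<close>

definition tapped :: "(bool \<Rightarrow> nat set) \<Rightarrow> bool \<Rightarrow> node set" where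
  "tapped X \<sigma> = (\<lambda>(s, i, \<kappa>). Clock \<sigma> s (if s then Suc i else i) \<kappa>) ` (UNIV \<times> X \<sigma> \<times> {..<fan \<sigma>})"

text \<open>For \<open>i \<noteq> t\<close>, exactly one of the two nodes tapped for
  \<open>i\<close> (per copy) is in state 1 at time \<open>t\<close>, and the conditional selects
  it. For \<open>i = t\<close> both are 0, so \<open>i\<close> is omitted here and counted twice in
  \<open>tapped_False\<close>.\<close>

definition tapped_True :: "(bool \<Rightarrow> nat set) \<Rightarrow> bool \<Rightarrow> nat \<Rightarrow> node set" where
  "tapped_True X \<sigma> t =
     (\<lambda>(i, \<kappa>). if t < i then Clock \<sigma> False i \<kappa> else Clock \<sigma> True (Suc i) \<kappa>) ` ((X \<sigma> - {t}) \<times> {..<fan \<sigma>})"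

definition tapped_False :: "(bool \<Rightarrow> nat set) \<Rightarrow> bool \<Rightarrow> nat \<Rightarrow> node set" where
  "tapped_False X \<sigma> t =
     (\<lambda>(i, \<kappa>). if i < t then Clock \<sigma> False i \<kappa> else Clock \<sigma> True (Suc i) \<kappa>) ` (X \<sigma> \<times> {..<fan \<sigma>})
     \<union> (if t \<in> X \<sigma> then Clock \<sigma> False t ` {..<fan \<sigma>} else {})"

lemma finite_X: "admissible X \<Longrightarrow> finite (X \<sigma>)"
  by (rule finite_subset[of _ "{..<M}"]) (auto dest: admissibleD(2))

lemma card_tapped_le: "admissible X \<Longrightarrow> card (tapped X \<sigma>) \<le> 2 * (card (X \<sigma>) * fan \<sigma>)"
  unfolding tapped_def
  by (rule order_trans[OF card_image_le]) (auto simp: finite_X card_cartesian_product)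

lemma card_tapped_True:
  assumes "admissible X"
  shows "card (tapped_True X \<sigma> t) = card (X \<sigma> - {t}) * fan \<sigma>"
  unfolding tapped_True_def
  by (subst card_image) (auto simp: inj_on_def card_cartesian_product split: if_splits)

lemma card_tapped_False:
  assumes "admissible X"
  shows "card (tapped_False X \<sigma> t) = (card (X \<sigma>) + (if t \<in> X \<sigma> then 1 else 0)) * fan \<sigma>"
proof -
  let ?I = "(\<lambda>(i, \<kappa>). if i < t then Clock \<sigma> False i \<kappa> else Clock \<sigma> True (Suc i) \<kappa>) ` (X \<sigma> \<times> {..<fan \<sigma>})"
  have "card ?I = card (X \<sigma>) * fan \<sigma>"
    by (subst card_image) (auto simp: inj_on_def card_cartesian_product split: if_splits)
  moreover have "?I \<inter> Clock \<sigma> False t ` {..<fan \<sigma>} = {}" by (auto split: if_splits)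
  ultimately show ?thesis
    unfolding tapped_False_def using finite_X[OF assms]
    by (auto simp: card_Un_disjoint)
qed

lemma tapped_adj:
  assumes "admissible X" "\<kappa> < width (target \<sigma>)"
  shows "tapped X \<sigma> \<subseteq> Nb X (Layer (target \<sigma>) \<kappa>)"
proof
  fix v assume "v \<in> tapped X \<sigma>"
  then obtain s i \<kappa>' where v: "v = Clock \<sigma> s (if s then Suc i else i) \<kappa>'"
    and i: "i \<in> X \<sigma>" and k: "\<kappa>' < fan \<sigma>" by (auto simp: tapped_def)
  have "1 \<le> i" "Suc i < M" using admissibleD[OF assms(1) i] by simp_all
  then have "is_node v" using v k fan_le[of \<sigma>] by simp
  moreover have "link X v (Layer (target \<sigma>) \<kappa>)" using v i k by (auto simp: taps_def)
  moreover have "is_node (Layer (target \<sigma>) \<kappa>)" using assms(2) by (auto split: if_splits)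
  ultimately show "v \<in> Nb X (Layer (target \<sigma>) \<kappa>)" by (simp add: Nb_def adj_def)
qed

lemma in_tapped:
  assumes "i \<in> X \<sigma>" "\<kappa> < fan \<sigma>"
  shows "Clock \<sigma> False i \<kappa> \<in> tapped X \<sigma>" "Clock \<sigma> True (Suc i) \<kappa> \<in> tapped X \<sigma>"
  unfolding tapped_def using assms
  by (auto intro: image_eqI[of _ _ "(False, i, \<kappa>)"] image_eqI[of _ _ "(True, i, \<kappa>)"])

lemma tapped_True_sub: "tapped_True X \<sigma> t \<subseteq> tapped X \<sigma>"
  and tapped_False_sub: "tapped_False X \<sigma> t \<subseteq> tapped X \<sigma>"
  unfolding tapped_True_def tapped_False_def by (auto simp: in_tapped split: if_splits)

lemma cfg_tapped_True: "v \<in> tapped_True X \<sigma> t \<Longrightarrow> cfg X t v = True"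
  and cfg_tapped_False: "v \<in> tapped_False X \<sigma> t \<Longrightarrow> cfg X t v = False"
  unfolding tapped_True_def tapped_False_def by (auto split: if_splits)

lemma tapped_no_zero:
  assumes "admissible X"
  shows "Clock \<sigma>' s 0 \<kappa> \<notin> tapped X \<sigma>"
  by (auto simp: tapped_def split: if_splits dest!: admissibleD(1)[OF assms])

lemma Layer_not_tapped: "Layer j \<kappa> \<notin> tapped X \<sigma>"
  by (auto simp: tapped_def)

lemma finite_tapped: "admissible X \<Longrightarrow> finite (tapped X \<sigma>)"
  unfolding tapped_def by (auto simp: finite_X)

lemma clock_nbr_tapped:
  assumes "adj X (Layer j \<kappa>) (Clock \<sigma> s i \<kappa>')" "i \<noteq> 0"
  shows "Clock \<sigma> s i \<kappa>' \<in> tapped X \<sigma>"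
proof -
  have "i \<in> taps X \<sigma> s" "\<kappa>' < fan \<sigma>" using assms(1) by (auto simp: adj_def)
  then obtain i' where "i' \<in> X \<sigma>" "i = (if s then Suc i' else i')"
    using assms(2) by (auto simp: taps_def split: if_splits)
  then show ?thesis using in_tapped[of i' X \<sigma> \<kappa>'] \<open>\<kappa>' < fan \<sigma>\<close> by (cases s) auto
qed

text \<open>The tapped pairs are split evenly, except that at a time in \<open>X False\<close> one
  pair gives \<open>B\<close> extra zeros. Otherwise the \<open>B\<close> constant ones tip the
  balance. Layer 1 has fewer than \<open>B\<close> nodes and can overturn neither outcome.\<close>

lemma forced_source:
  assumes adm: "admissible X" and k: "\<kappa> < width 0"
  shows "forced X (cfg X t) (Layer 0 \<kappa>) (cfg X (Suc t) (Layer 0 \<kappa>))"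
proof -
  let ?Z = "Clock False True 0 ` {..<B}"
  let ?D = "Layer 1 ` {..<width 1} \<union> ?Z \<union> tapped X False"
  have sub: "Nb X (Layer 0 \<kappa>) \<subseteq> ?D"
  proof
    fix v assume "v \<in> Nb X (Layer 0 \<kappa>)"
    then have v: "adj X (Layer 0 \<kappa>) v" by (simp add: Nb_def)
    show "v \<in> ?D"
    proof (cases v)
      case (Clock \<sigma> s i \<kappa>')
      have link: "link X (Clock \<sigma> s i \<kappa>') (Layer 0 \<kappa>)" using v Clock by (simp add: adj_def)
      have "\<not> \<sigma>" using link by (cases \<sigma>) auto
      moreover have "i \<in> taps X \<sigma> s" "\<kappa>' < fan \<sigma>" using link by auto
      ultimately have "\<not> \<sigma>" "\<kappa>' < B" "i \<in> taps X False s" by (simp_all add: fan_def)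
      show ?thesis
      proof (cases "i = 0")
        case True
        have "0 \<notin> X False" using admissibleD(3)[OF adm] by blast
        then have s using \<open>i \<in> taps X False s\<close> True by (auto simp: taps_def split: if_splits)
        then have "v \<in> ?Z" using Clock True \<open>\<not> \<sigma>\<close> \<open>\<kappa>' < B\<close> by simp
        then show ?thesis by blast
      next
        case False
        then have "v \<in> tapped X False"
          using clock_nbr_tapped[of X 0 \<kappa> \<sigma> s i \<kappa>'] v Clock \<open>\<not> \<sigma>\<close> by simp
        then show ?thesis by blast
      qed
    next
      case (Layer j \<kappa>')
      then show ?thesis using v r_pos by (auto simp: adj_def)
    qed
  qed
  have fin: "finite ?D" using finite_tapped[OF adm] by auto
  have "card ?D \<le> width 1 + B + 2 * (card (X False) * fan False)"
    using card_Un_le[of "Layer 1 ` {..<width 1} \<union> ?Z" "tapped X False"]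
      card_Un_le[of "Layer 1 ` {..<width 1}" ?Z] card_tapped_le[OF adm, of False] by simp
  then have D: "card ?D < 2 * (B + card (X False) * B)"
    using width_le[of 1] by (simp add: fan_def)
  have Z: "?Z \<subseteq> Nb X (Layer 0 \<kappa>)"
    using k K_gt by (auto simp: Nb_def adj_def taps_def fan_def)
  have T: "tapped X False \<subseteq> Nb X (Layer 0 \<kappa>)"
    using tapped_adj[OF adm, of \<kappa> False] k by simp
  show ?thesis
  proof (cases "t \<in> X False")
    case True
    show ?thesis
    proof (rule forcedI[OF _ _ sub fin])
      show "tapped_False X False t \<subseteq> Nb X (Layer 0 \<kappa>)" using T tapped_False_sub by blast
      show "card ?D < 2 * card (tapped_False X False t)"
        using D True by (simp add: card_tapped_False[OF adm] fan_def algebra_simps)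
      show "cfg X t v = cfg X (Suc t) (Layer 0 \<kappa>)" if "v \<in> tapped_False X False t" for v
        using cfg_tapped_False[OF that] True by simp
    qed
  next
    case False
    have "?Z \<inter> tapped_True X False t = {}"
      using tapped_no_zero[OF adm] tapped_True_sub by blast
    moreover have "finite (tapped_True X False t)"
      using finite_tapped[OF adm] tapped_True_sub by (rule rev_finite_subset)
    ultimately have "card (?Z \<union> tapped_True X False t) = B + card (X False) * B"
      using False by (simp add: card_Un_disjoint card_tapped_True[OF adm] fan_def)
    then have card: "card ?D < 2 * card (?Z \<union> tapped_True X False t)" using D by simp
    show ?thesis
    proof (rule forcedI[OF _ _ sub fin card])
      show "?Z \<union> tapped_True X False t \<subseteq> Nb X (Layer 0 \<kappa>)"
        by (rule Un_least[OF Z order_trans[OF tapped_True_sub T]])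
      show "cfg X t v = cfg X (Suc t) (Layer 0 \<kappa>)" if "v \<in> ?Z \<union> tapped_True X False t" for v
        using that cfg_tapped_True[of v X False t] False by auto
    qed
  qed
qed

lemma alarm_Suc: "alarm X (Suc t) \<longleftrightarrow> alarm X t \<or> t \<in> X True \<and> r < t \<and> t - Suc r \<in> X False"
  unfolding alarm_def by (auto simp: less_Suc_eq)

text \<open>There are at most \<open>5 + 2 * card (X True)\<close> neighbours: layer
  \<open>r\<close>, the two other detector nodes, two opposite constants and the tapped pairs. So
  \<open>3 + card (X True)\<close> equal votes decide.\<close>

lemma forced_detector:
  assumes adm: "admissible X" and k: "\<kappa> < 3"
  shows "forced X (cfg X t) (Layer (Suc r) \<kappa>) (cfg X (Suc t) (Layer (Suc r) \<kappa>))"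
proof -
  let ?R = "{Layer r 0}"
  let ?O = "Layer (Suc r) ` ({..<3} - {\<kappa>})"
  let ?Z = "{Clock True True 0 0, Clock True False 0 0}"
  let ?N = "Nb X (Layer (Suc r) \<kappa>)"
  let ?D = "?R \<union> ?O \<union> ?Z \<union> tapped X True"
  have w: "width r = 1" "width (Suc r) = 3" by (auto simp: width_def)
  have sub: "?N \<subseteq> ?D"
  proof
    fix v assume "v \<in> ?N"
    then have v: "adj X (Layer (Suc r) \<kappa>) v" by (simp add: Nb_def)
    show "v \<in> ?D"
    proof (cases v)
      case (Clock \<sigma> s i \<kappa>')
      have link: "link X (Clock \<sigma> s i \<kappa>') (Layer (Suc r) \<kappa>)" using v Clock by (simp add: adj_def)
      have \<sigma> using link by (cases \<sigma>) auto
      moreover have "\<kappa>' < fan \<sigma>" using link by auto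
      ultimately have "\<sigma>" "\<kappa>' = 0" by (simp_all add: fan_def)
      show ?thesis
      proof (cases "i = 0")
        case True
        then have "v \<in> ?Z" using Clock \<open>\<sigma>\<close> \<open>\<kappa>' = 0\<close> by (cases s) simp_all
        then show ?thesis by blast
      next
        case False
        then have "v \<in> tapped X True"
          using clock_nbr_tapped[of X "Suc r" \<kappa> \<sigma> s i \<kappa>'] v Clock \<open>\<sigma>\<close> by simp
        then show ?thesis by blast
      qed
    next
      case (Layer j \<kappa>')
      then show ?thesis using v w by (auto simp: adj_def)
    qed
  qed
  have fin: "finite ?D" using finite_tapped[OF adm] by auto
  have cO: "card ?O = 2" using k by simp
  have "card ?D \<le> card ?R + card ?O + card ?Z + card (tapped X True)" by (rule card_Un4_le)
  then have D: "card ?D < 2 * (3 + card (X True))"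
    using card_tapped_le[OF adm, of True] cO by (simp add: fan_def)
  have nbrs: "?R \<subseteq> ?N" "?O \<subseteq> ?N" "?Z \<subseteq> ?N" "tapped X True \<subseteq> ?N"
    using k K_gt[of 0] w tapped_adj[OF adm, of \<kappa> True]
    by (auto simp: Nb_def adj_def taps_def fan_def)
  have detect: ?thesis
    if "Y \<subseteq> ?R \<union> ?O \<union> ?Z" "W \<subseteq> tapped X True"
      and "\<And>v. v \<in> Y \<union> W \<Longrightarrow> cfg X t v = cfg X (Suc t) (Layer (Suc r) \<kappa>)"
      and "3 + card (X True) \<le> card Y + card W" for Y W
  proof (rule forcedI[OF _ that(3) sub fin])
    show "Y \<union> W \<subseteq> ?N" using that nbrs by blast
    have "Y \<inter> tapped X True = {}"
      using that(1) tapped_no_zero[OF adm] Layer_not_tapped by blast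
    then have "Y \<inter> W = {}" using that(2) by blast
    moreover have "finite Y" "finite W"
      using that(1,2) finite_tapped[OF adm] by (auto intro: finite_subset)
    ultimately have "card (Y \<union> W) = card Y + card W" by (simp add: card_Un_disjoint)
    then show "card ?D < 2 * card (Y \<union> W)" using D that(4) by simp
  qed
  have cOZ: "card (insert (Clock True s 0 0) ?O) = 3" for s
    using cO by (subst card_insert_disjoint) auto
  have cT: "card (tapped_True X True t) = card (X True - {t})"
    and cF: "card (tapped_False X True t) = card (X True) + (if t \<in> X True then 1 else 0)"
    using card_tapped_True[OF adm, of True t] card_tapped_False[OF adm, of True t]
    by (simp_all add: fan_def)
  note finX = finite_X[OF adm, of True]
  let ?sig = "r < t \<and> t - Suc r \<in> X False"
  \<comment> \<open>In order: the alarm sustains itself; two pulses coincide; Bob sends no pulse,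
    and the vote of the channel is left out of the count as it may be either; Bob's pulse comes
    alone.\<close>
  consider "alarm X t" | "\<not> alarm X t" "t \<in> X True" "?sig" | "\<not> alarm X t" "t \<notin> X True"
    | "\<not> alarm X t" "t \<in> X True" "\<not> ?sig" by blast
  then show ?thesis
  proof cases
    case 1
    show ?thesis
      by (rule detect[of "insert (Clock True False 0 0) ?O" "tapped_False X True t"])
        (use 1 tapped_False_sub cOZ cF in \<open>auto simp: alarm_Suc cfg_tapped_False\<close>)
  next
    case 2
    show ?thesis
      by (rule detect[of "{Layer r 0, Clock True False 0 0}" "tapped_False X True t"])
        (use 2 tapped_False_sub cF in \<open>auto simp: alarm_Suc cfg_tapped_False\<close>)
  next
    case 3
    show ?thesis
      by (rule detect[of "insert (Clock True True 0 0) ?O" "tapped_True X True t"])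
        (use 3 tapped_True_sub cOZ cT in \<open>auto simp: alarm_Suc cfg_tapped_True\<close>)
  next
    case 4
    have "card (insert (Layer r 0) (insert (Clock True True 0 0) ?O)) = 4"
    proof -
      have "card (insert (Layer r 0) (insert (Clock True True 0 0) ?O))
          = Suc (card (insert (Clock True True 0 0) ?O))"
      proof (rule card_insert_disjoint)
        show "finite (insert (Clock True True 0 0) ?O)" by simp
        have "r \<noteq> Suc r" by simp
        then show "Layer r 0 \<notin> insert (Clock True True 0 0) ?O" by blast
      qed
      then show ?thesis using cOZ[of True] by linarith
    qed
    moreover have "Suc (card (X True - {t})) = card (X True)"
      using card.remove[OF finX 4(2)] by simp
    ultimately have c: "3 + card (X True) \<le> card (insert (Layer r 0) (insert (Clock True True 0 0) ?O))
        + card (tapped_True X True t)" using cT by linarith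
    show ?thesis
      by (rule detect[of "insert (Layer r 0) (insert (Clock True True 0 0) ?O)" "tapped_True X True t"])
        (use 4 tapped_True_sub c in \<open>auto simp: alarm_Suc cfg_tapped_True simp del: card_insert_disjoint\<close>)
  qed
qed

lemma forced_cfg:
  assumes "admissible X" "u \<in> nodes"
  shows "forced X (cfg X t) u (cfg X (Suc t) u)"
proof (cases u)
  case (Clock \<sigma> s i \<kappa>)
  then show ?thesis
    using assms forced_clique[OF assms(1), of \<kappa> \<sigma> s t] forced_clock[OF assms(1), of i \<kappa> t \<sigma> s]
    by (cases "i = 0") (auto simp: nodes_def)
next
  case (Layer j \<kappa>)
  then have "j \<le> Suc r" "\<kappa> < width j" using assms(2) by (auto simp: nodes_def)
  then consider "j = 0" | "1 \<le> j" "j \<le> r" | "j = Suc r" by linarith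
  then show ?thesis
    using forced_source[OF assms(1)] forced_layer forced_detector[OF assms(1)] Layer \<open>\<kappa> < width j\<close>
    by cases (auto simp: width_def simp del: cfg.simps)
qed

end

section \<open>The instances\<close>

lemma majority_step_forced:
  assumes fin: "finite (nbrs G u)" and C: "C \<subseteq> nbrs G u" "\<And>v. v \<in> C \<Longrightarrow> x v = b"
    and big: "card (nbrs G u) < 2 * card C"
  shows "majority_step G x u = b"
proof -
  let ?T = "{v \<in> nbrs G u. x v}"
  have sum: "(\<Sum>v\<in>nbrs G u. of_bool (x v) :: real) = real (card ?T)"
    using fin by (simp add: of_bool_def sum.If_cases Int_def)
  show ?thesis
  proof (cases b)
    case True
    have "card C \<le> card ?T" using fin C True by (intro card_mono) auto
    then have "2 * card ?T > card (nbrs G u)" using big by linarith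
    then show ?thesis using True by (simp add: majority_step_def sum deg_def Let_def)
  next
    case False
    have "card ?T \<le> card (nbrs G u - C)" using fin C False by (intro card_mono) auto
    also have "\<dots> = card (nbrs G u) - card C"
      using fin C(1) by (intro card_Diff_subset) (auto intro: finite_subset)
    finally have "2 * card ?T < card (nbrs G u)"
      using big card_mono[OF fin C(1)] by linarith
    then show ?thesis using False by (simp add: majority_step_def sum deg_def Let_def)
  qed
qed

section \<open>Counting the nodes, with the clocks grouped by final state\<close>

context clock_network
begin

definition clocks :: "bool \<Rightarrow> bool \<Rightarrow> node set" where
  "clocks \<sigma> s = (\<lambda>(i, \<kappa>). Clock \<sigma> s i \<kappa>) ` (SIGMA i:{..M}. {..<if i = 0 then K \<sigma> s else B})"

definition layers :: "node set" where
  "layers = (\<lambda>(j, \<kappa>). Layer j \<kappa>) ` (SIGMA j:{..Suc r}. {..<width j})"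

definition layer_count :: nat where "layer_count = (\<Sum>j\<le>Suc r. width j)"

lemma card_clocks: "card (clocks \<sigma> s) = K \<sigma> s + M * B"
proof -
  have "card (clocks \<sigma> s) = (\<Sum>i\<le>M. if i = 0 then K \<sigma> s else B)"
    unfolding clocks_def by (subst card_image) (auto simp: inj_on_def)
  also have "\<dots> = K \<sigma> s + (\<Sum>i\<in>{1..M}. B)"
    by (simp add: sum.atMost_shift atLeast0LessThan[symmetric] del: sum_constant)
       (simp add: sum.If_cases)
  finally show ?thesis by simp
qed

lemma card_layers: "card layers = layer_count"
  unfolding layers_def layer_count_def by (subst card_image) (auto simp: inj_on_def)

lemma clocks_iff: "Clock \<sigma>' s' i \<kappa> \<in> clocks \<sigma> s \<longleftrightarrow> \<sigma>' = \<sigma> \<and> s' = s \<and> is_node (Clock \<sigma>' s' i \<kappa>)"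
  by (auto simp: clocks_def split: if_splits)

lemma layers_iff: "Layer j \<kappa> \<in> layers \<longleftrightarrow> is_node (Layer j \<kappa>)"
  by (auto simp: layers_def)

lemma Layer_clocks: "Layer j \<kappa> \<notin> clocks \<sigma> s" and Clock_layers: "Clock \<sigma> s i \<kappa> \<notin> layers"
  by (auto simp: clocks_def layers_def)

lemmas block_iffs = clocks_iff layers_iff Layer_clocks Clock_layers

lemma finite_blocks: "finite (clocks \<sigma> s)" "finite layers"
  by (auto simp: clocks_def layers_def)

lemma clocks_disjoint:
  "clocks True s \<inter> clocks False s' = {}" "clocks \<sigma> True \<inter> clocks \<sigma>' False = {}"
  "clocks \<sigma> s \<inter> layers = {}"
  by (auto simp: clocks_def layers_def)

lemma nodes_blocks:
  "nodes = (clocks True True \<union> clocks False True) \<union> (clocks True False \<union> clocks False False) \<union> layers"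
  (is "_ = ?U")
proof (rule set_eqI)
  fix u show "u \<in> nodes \<longleftrightarrow> u \<in> ?U"
    by (cases u) (auto simp: nodes_def block_iffs simp del: is_node.simps)
qed

lemma card_nodes: "card nodes = (K True True + K False True + 2 * (M * B))
    + (K True False + K False False + 2 * (M * B)) + layer_count"
proof -
  have "(clocks True True \<union> clocks False True) \<inter> (clocks True False \<union> clocks False False) = {}"
    using clocks_disjoint by blast
  moreover have "((clocks True True \<union> clocks False True) \<union> (clocks True False \<union> clocks False False)) \<inter> layers = {}"
    using clocks_disjoint by blast
  ultimately show ?thesis
    unfolding nodes_blocks
    by (simp add: card_Un_disjoint finite_blocks clocks_disjoint card_clocks card_layers)
qed

end

text \<open>Numbering the nodes by \<open>1, ..., n\<close> lets each vertex be its own identifier,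
  which is legal since \<open>c > 1\<close>.\<close>

locale numbered_clock_network = clock_network +
  fixes e :: "node \<Rightarrow> nat"
  assumes e_bij: "bij_betw e nodes {1..card nodes}"
begin

definition graph :: "(bool \<Rightarrow> nat set) \<Rightarrow> ngraph" where
  "graph X = \<lparr>pverts = e ` nodes, parcs = {(e u, e v) | u v. adj X u v}\<rparr>"

definition dec :: "nat \<Rightarrow> node" where "dec = the_inv_into nodes e"

lemma e_inj: "inj_on e nodes"
  using e_bij by (simp add: bij_betw_def)

lemma dec_e [simp]: "u \<in> nodes \<Longrightarrow> dec (e u) = u"
  unfolding dec_def using e_inj by (rule the_inv_into_f_f)

lemma adj_nodes: "adj X u v \<Longrightarrow> u \<in> nodes \<and> v \<in> nodes"
  by (simp add: adj_def nodes_def)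

lemma parcs_graph:
  "(a, b) \<in> parcs (graph X) \<longleftrightarrow> a \<in> e ` nodes \<and> b \<in> e ` nodes \<and> adj X (dec a) (dec b)"
proof
  assume "(a, b) \<in> parcs (graph X)"
  then obtain u v where "a = e u" "b = e v" "adj X u v" by (auto simp: graph_def)
  then show "a \<in> e ` nodes \<and> b \<in> e ` nodes \<and> adj X (dec a) (dec b)"
    using adj_nodes[of X u v] by simp
next
  assume "a \<in> e ` nodes \<and> b \<in> e ` nodes \<and> adj X (dec a) (dec b)"
  then obtain u v where "a = e u" "b = e v" "adj X u v" by auto
  then have "\<exists>u v. (a, b) = (e u, e v) \<and> adj X u v" by blast
  then show "(a, b) \<in> parcs (graph X)" by (simp add: graph_def)
qed

lemma pverts_graph [simp]: "pverts (graph X) = e ` nodes"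
  by (simp add: graph_def)

lemma card_pverts [simp]: "card (e ` nodes) = card nodes"
  using e_inj by (rule card_image)

lemma nbrs_graph: "u \<in> nodes \<Longrightarrow> nbrs (graph X) (e u) = e ` Nb X u"
  using Nb_subset[of X u] by (force simp: nbrs_def parcs_graph Nb_def)

lemma adj_sym: "adj X u v \<Longrightarrow> adj X v u"
  by (auto simp: adj_def)

lemma not_adj_self: "\<not> adj X u u"
  by (cases u) (auto simp: adj_def)

lemma pair_graph_graph: "pair_graph (graph X)"
proof unfold_locales
  fix a assume "a \<in> parcs (graph X)"
  then have *: "(fst a, snd a) \<in> parcs (graph X)" by simp
  show "fst a \<in> pverts (graph X)" "snd a \<in> pverts (graph X)"
    using * unfolding parcs_graph by simp_all
  show "fst a \<noteq> snd a"
    using * not_adj_self[of X "dec (fst a)"] unfolding parcs_graph by metis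
next
  show "finite (pverts (graph X))" using finite_nodes by simp
  have "parcs (graph X) \<subseteq> e ` nodes \<times> e ` nodes" by (auto simp: parcs_graph)
  then show "finite (parcs (graph X))" using finite_nodes by (meson finite_SigmaI finite_imageI finite_subset)
next
  show "symmetric (with_proj (graph X))"
    unfolding symmetric_def with_proj_simps by (rule symI) (auto simp: parcs_graph adj_sym)
qed

section \<open>Connectedness\<close>

definition joined :: "(bool \<Rightarrow> nat set) \<Rightarrow> node \<Rightarrow> node \<Rightarrow> bool" where
  "joined X u v \<longleftrightarrow> (u, v) \<in> {(u, v). adj X u v}\<^sup>*"

lemma joined_adj: "adj X u v \<Longrightarrow> joined X v w \<Longrightarrow> joined X u w"
  unfolding joined_def by (rule converse_rtrancl_into_rtrancl) simp

lemma joined_refl: "joined X u u"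
  by (simp add: joined_def)

lemma joined_trans: "joined X u v \<Longrightarrow> joined X v w \<Longrightarrow> joined X u w"
  unfolding joined_def by (rule rtrancl_trans)

lemma joined_sym: "joined X u v \<Longrightarrow> joined X v u"
  unfolding joined_def by (rule symD[OF sym_rtrancl]) (auto intro: symI adj_sym)

lemma width_pos: "0 < width j"
  by (simp add: width_def)

lemma joined_layer:
  "j \<le> Suc r \<Longrightarrow> \<kappa> < width j \<Longrightarrow> joined X (Layer j \<kappa>) (Layer 0 0)"
proof (induction j arbitrary: \<kappa>)
  case 0
  have "adj X (Layer 0 \<kappa>) (Layer 1 0)" "adj X (Layer 1 0) (Layer 0 0)"
    using 0 width_pos by (auto simp: adj_def)
  then show ?case using joined_adj joined_refl by blast
next
  case (Suc j)
  have "adj X (Layer (Suc j) \<kappa>) (Layer j 0)" using Suc.prems width_pos by (auto simp: adj_def)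
  then show ?case using joined_adj Suc.IH[of 0] Suc.prems width_pos by auto
qed

lemma joined_clock:
  "is_node (Clock \<sigma> s i \<kappa>) \<Longrightarrow> joined X (Clock \<sigma> s i \<kappa>) (Clock \<sigma> s 0 0)"
proof (induction i arbitrary: \<kappa>)
  case 0
  show ?case
  proof (cases "\<kappa> = 0")
    case False
    then have "adj X (Clock \<sigma> s 0 \<kappa>) (Clock \<sigma> s 0 0)" using 0 K_gt[of 0] by (auto simp: adj_def)
    then show ?thesis using joined_adj joined_refl by blast
  qed (simp add: joined_refl)
next
  case (Suc i)
  have "adj X (Clock \<sigma> s (Suc i) \<kappa>) (Clock \<sigma> s i 0)" using Suc.prems K_gt[of 0] by (auto simp: adj_def)
  moreover have "is_node (Clock \<sigma> s i 0)" using Suc.prems K_gt[of 0] by auto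
  ultimately show ?case using joined_adj Suc.IH by blast
qed

text \<open>The route descends a clock to level 0, crosses to the \<open>True\<close> clique, enters
  the channel through the constant tap at level 0 and runs back to layer 0. None of these arcs
  depends on \<open>X\<close>.\<close>

lemma joined_root:
  assumes "u \<in> nodes"
  shows "joined X u (Layer 0 0)"
proof -
  have u: "is_node u" using assms by (simp add: nodes_def)
  have base: "joined X (Clock \<sigma> s 0 0) (Layer 0 0)" for \<sigma> s
  proof -
    have tap: "adj X (Clock \<sigma> True 0 0) (Layer (target \<sigma>) 0)"
      using K_gt[of 0] width_pos by (auto simp: adj_def taps_def fan_def)
    have T: "joined X (Clock \<sigma> True 0 0) (Layer 0 0)"
      by (rule joined_adj[OF tap joined_layer]) (use width_pos in auto)
    have "adj X (Clock \<sigma> False 0 0) (Clock \<sigma> True 0 0)"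
      using K_gt[of 0] by (auto simp: adj_def)
    then show ?thesis using T joined_adj by (cases s) auto
  qed
  show ?thesis
  proof (cases u)
    case (Clock \<sigma> s i \<kappa>)
    then show ?thesis using u joined_trans[OF joined_clock base] by blast
  next
    case (Layer j \<kappa>)
    then show ?thesis using u joined_layer by simp
  qed
qed

lemma simple_connected_graph: "simple_connected (graph X)"
proof -
  let ?R = "parcs (graph X)" and ?V = "e ` nodes"
  have edge: "(e u, e v) \<in> ?R" if "adj X u v" for u v
    using that by (auto simp: graph_def)
  have reach: "(e u, e v) \<in> rtrancl_on ?V (?R\<^sup>s)" if uv: "u \<in> nodes" "v \<in> nodes" for u v
  proof -
    have "joined X u v" using joined_trans[OF joined_root[OF uv(1)] joined_sym[OF joined_root[OF uv(2)]]] .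
    then have "(u, v) \<in> {(u, v). adj X u v}\<^sup>*" by (simp add: joined_def)
    then have "(e u, e v) \<in> (?R\<^sup>s)\<^sup>*"
    proof (induction rule: rtrancl_induct)
      case (step y z)
      then have "(e y, e z) \<in> ?R\<^sup>s" using edge by (auto simp: symcl_def)
      then show ?case using step.IH by simp
    qed simp
    then show ?thesis
    proof (rule rtrancl_consistent_rtrancl_on)
      show "b \<in> ?V" if "a \<in> ?V" "(a, b) \<in> ?R\<^sup>s" for a b
        using that by (auto simp: symcl_def parcs_graph)
    qed (use uv in auto)
  qed
  have "Layer 0 0 \<in> nodes" using width_pos by (simp add: nodes_def)
  then have "connected (with_proj (graph X))"
    unfolding connected_conv with_proj_simps pverts_graph using reach by blast
  then show ?thesis unfolding simple_connected_def using pair_graph_graph by blast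
qed

lemma id_assignment_id:
  assumes "1 < c"
  shows "id_assignment c (graph X) (\<lambda>v. v)"
  unfolding id_assignment_def
proof (intro conjI ballI)
  fix v assume "v \<in> pverts (graph X)"
  then have v: "1 \<le> v" "v \<le> card nodes" using e_bij by (auto simp: bij_betw_def)
  show "1 \<le> v" by (rule v(1))
  have "real v \<le> real (card nodes) powr 1" using v by simp
  also have "\<dots> \<le> real (card nodes) powr c" using v assms by (intro powr_mono) auto
  finally show "real v \<le> real (card (pverts (graph X))) powr c" by simp
qed (simp add: inj_on_def)

section \<open>The trajectory of the common initial configuration\<close>

definition init :: config where "init m = cfg (\<lambda>_. {}) 0 (dec m)"

text \<open>The fooling set needs one input for all graphs. At time 0 no pulse is in the channel and
  no alarm is raised, so the empty wiring in \<open>init\<close> stands for every wiring.\<close>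

lemma cfg_0: "cfg X 0 u = cfg Y 0 u"
  by (cases u) (auto simp: alarm_def)

lemma dynamics_cfg:
  assumes "admissible X" "u \<in> nodes"
  shows "majority_dynamics (graph X) init t (e u) = cfg X t u"
  using assms(2)
proof (induction t arbitrary: u)
  case 0
  then show ?case using cfg_0 by (simp add: majority_dynamics_def init_def del: cfg.simps)
next
  case (Suc t)
  obtain C where C: "C \<subseteq> Nb X u" "\<forall>v\<in>C. cfg X t v = cfg X (Suc t) u"
    "card (Nb X u) < 2 * card C"
    using forced_cfg[OF assms(1) Suc.prems, of t] unfolding forced_def by blast
  have inj: "inj_on e (Nb X u)" "inj_on e C"
    using e_inj Nb_subset C(1) by (meson inj_on_subset)+
  have "majority_step (graph X) (majority_dynamics (graph X) init t) (e u) = cfg X (Suc t) u"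
  proof (rule majority_step_forced)
    show "finite (nbrs (graph X) (e u))" using finite_Nb Suc.prems by (simp add: nbrs_graph)
    show "e ` C \<subseteq> nbrs (graph X) (e u)" using C(1) Suc.prems by (auto simp: nbrs_graph)
    show "majority_dynamics (graph X) init t v = cfg X (Suc t) u" if v: "v \<in> e ` C" for v
    proof -
      obtain w where w: "w \<in> C" "v = e w" using v by blast
      then have "w \<in> nodes" using C(1) Nb_subset by blast
      then show ?thesis using Suc.IH[of w] w C(2) by simp
    qed
    show "card (nbrs (graph X) (e u)) < 2 * card (e ` C)"
      using C(3) inj Suc.prems by (simp add: nbrs_graph card_image)
  qed
  then show ?case by (simp add: majority_dynamics_def)
qed

text \<open>Bob's clocks share the position of the detector, so positions \<open>1\<close> to
  \<open>r + 1\<close> are exactly the layers \<open>0\<close> to \<open>r\<close>. With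
  \<open>r = 2 * t\<close> these are the middle part of the fooling set argument.\<close>

fun layer_pos :: "node \<Rightarrow> nat" where
  "layer_pos (Clock \<sigma> s i \<kappa>) = (if \<sigma> then Suc (Suc r) else 0)"
| "layer_pos (Layer j \<kappa>) = Suc j"

definition pos :: "nat \<Rightarrow> nat" where "pos m = layer_pos (dec m)"

lemma link_pos: "link X u v \<Longrightarrow> layer_pos v \<le> layer_pos u + 1 \<and> layer_pos u \<le> layer_pos v + 1"
  by (cases u; cases v) (auto split: if_splits)

text \<open>\<open>X \<sigma>\<close> enters only the arcs between the clocks of side
  \<open>\<sigma>\<close> and their layer: positions 0 and 1 for Alice, position
  \<open>r + 2\<close> for Bob.\<close>

lemma link_left:
  assumes "X False = Y False" "layer_pos u \<le> Suc r" "layer_pos v \<le> Suc r"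
  shows "link X u v = link Y u v"
  using assms by (cases u; cases v) (auto simp: taps_def split: if_splits)

lemma link_right:
  assumes "X True = Y True" "1 \<le> layer_pos u" "1 \<le> layer_pos v"
  shows "link X u v = link Y u v"
  using assms by (cases u; cases v) (auto simp: taps_def split: if_splits)

lemma card_middle: "card {v \<in> e ` nodes. 1 \<le> pos v \<and> pos v \<le> Suc r} \<le> Suc r * B"
proof -
  have "{v \<in> e ` nodes. 1 \<le> pos v \<and> pos v \<le> Suc r}
      \<subseteq> (\<lambda>(j, \<kappa>). e (Layer j \<kappa>)) ` ({..r} \<times> {..<B})" (is "?M \<subseteq> ?I")
  proof
    fix v assume "v \<in> ?M"
    then obtain u where u: "v = e u" "u \<in> nodes" "1 \<le> layer_pos u" "layer_pos u \<le> Suc r"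
      by (auto simp: pos_def)
    then obtain j \<kappa> where j: "u = Layer j \<kappa>" by (cases u) (auto split: if_splits)
    then have "j \<le> r" "\<kappa> < B" using u width_le[of j] by (auto simp: nodes_def)
    then show "v \<in> ?I" using u j by (intro image_eqI[of _ _ "(j, \<kappa>)"]) auto
  qed
  then have "card ?M \<le> card ?I" by (intro card_mono) auto
  also have "\<dots> \<le> card ({..r} \<times> {..<B})" by (intro card_image_le) auto
  finally show ?thesis by (simp add: card_cartesian_product)
qed

end

text \<open>
  \<open>balanced\<close> makes the election so close that the three detector nodes decide it.
\<close>

locale disjointness_network = numbered_clock_network +
  fixes m :: nat
  assumes M_eq: "M = m + r + 3"
    and balanced: "K True False + K False False < K True True + K False True + layer_count"
      "K True True + K False True + layer_count \<le> K True False + K False False + 6"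
begin

text \<open>
  The pulse for \<open>i\<close> leaves Alice's clock at time \<open>i\<close> and is in layer \<open>r\<close> at time \<open>i + r + 1\<close>.
\<close>

definition wiring :: "nat set \<Rightarrow> nat set \<Rightarrow> bool \<Rightarrow> nat set" where
  "wiring S S' \<sigma> = (if \<sigma> then (\<lambda>i. i + Suc r) ` ({1..m} - S') else S)"

text \<open>Bob's latest pulse is at \<open>m + r + 1\<close> and also taps level
  \<open>m + r + 2\<close>, which must lie below the last level; hence the choice of
  \<open>M\<close>.\<close>

lemma admissible_wiring: "S \<subseteq> {1..m} \<Longrightarrow> admissible (wiring S S')"
  unfolding admissible_def wiring_def by (auto simp: M_eq)

text \<open>Bob taps the complement of \<open>S'\<close>, delayed by the length of the channel, so
  two pulses meet at the detector exactly for an element of \<open>S - S'\<close>, and this happens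
  before time \<open>M\<close>.\<close>

lemma alarm_wiring:
  assumes "S \<subseteq> {1..m}"
  shows "alarm (wiring S S') M \<longleftrightarrow> \<not> S \<subseteq> S'"
proof
  assume "alarm (wiring S S') M"
  then show "\<not> S \<subseteq> S'" by (auto simp: alarm_def wiring_def)
next
  assume "\<not> S \<subseteq> S'"
  then obtain i where "i \<in> S" "i \<notin> S'" by blast
  then show "alarm (wiring S S') M"
    unfolding alarm_def using assms
    by (intro exI[of _ "i + Suc r"]) (auto simp: wiring_def M_eq)
qed

definition final :: "nat \<Rightarrow> bool" where
  "final v = (case dec v of Clock \<sigma> s i \<kappa> \<Rightarrow> s | Layer j \<kappa> \<Rightarrow> True)"

lemma cfg_final:
  assumes "S \<subseteq> {1..m}" "u \<in> nodes"
  shows "cfg (wiring S S') M u =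
    (case u of Clock \<sigma> s i \<kappa> \<Rightarrow> s | Layer j \<kappa> \<Rightarrow> j = Suc r \<longrightarrow> S \<subseteq> S')"
proof (cases u)
  case (Clock \<sigma> s i \<kappa>)
  then show ?thesis using assms(2) by (auto simp: nodes_def split: if_splits)
next
  case (Layer j \<kappa>)
  show ?thesis
  proof (cases "j \<le> r")
    case True
    \<comment> \<open>At time \<open>M\<close> the last pulse has left the channel.\<close>
    then have "m < M - Suc j" by (simp add: M_eq)
    then have "M - Suc j \<notin> S" using assms(1) by (meson atLeastAtMost_iff not_le subsetD)
    then show ?thesis using Layer True by (simp add: wiring_def)
  next
    case False
    then have "j = Suc r" using assms(2) Layer by (auto simp: nodes_def)
    then show ?thesis using Layer alarm_wiring[OF assms(1)] by simp
  qed
qed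

lemma final_state:
  assumes "S \<subseteq> {1..m}" "u \<in> nodes"
  shows "majority_dynamics (graph (wiring S S')) init M (e u) =
    (case u of Clock \<sigma> s i \<kappa> \<Rightarrow> s | Layer j \<kappa> \<Rightarrow> j = Suc r \<longrightarrow> S \<subseteq> S')"
  using dynamics_cfg[OF admissible_wiring[OF assms(1)] assms(2)] cfg_final[OF assms] by simp

text \<open>The fooling set consists of all \<open>2 ^ m\<close> subsets. The cut has at most
  \<open>Suc r * B\<close> nodes with at most \<open>2 ^ Suc l\<close> certificates each; comparing
  exponents gives the bound.\<close>

lemma certificate_bound:
  assumes c: "1 < c" and lcp: "locally_checkable_proof c I L P t A" and t: "r = 2 * t"
    and inst: "\<And>S S'. S \<subseteq> {1..m} \<Longrightarrow> S' \<subseteq> {1..m} \<Longrightarrow> (graph (wiring S S'), inp) \<in> I"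
    and lang: "\<And>S S'. S \<subseteq> {1..m} \<Longrightarrow> S' \<subseteq> {1..m} \<Longrightarrow>
        (graph (wiring S S'), inp) \<in> L \<longleftrightarrow> S \<subseteq> S'"
    and size: "certificate_size c L P (card nodes) = enat l"
  shows "m \<le> Suc l * (Suc r * B)"
proof -
  let ?G = "\<lambda>S S'. graph (wiring S S')"
  have len: "length (P (?G S S) (\<lambda>v. v) inp v) \<le> l" if "S \<in> Pow {1..m}" "v \<in> e ` nodes" for S v
  proof -
    have "(?G S S, inp) \<in> L" using lang that by simp
    moreover have "card (pverts (?G S S)) = card nodes" by simp
    moreover have "v \<in> pverts (?G S S)" using that by simp
    ultimately have "enat (length (P (?G S S) (\<lambda>v. v) inp v)) \<le> certificate_size c L P (card nodes)"
      unfolding certificate_size_def using id_assignment_id[OF c, of "wiring S S"]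
      by (intro Sup_upper) blast
    then show ?thesis by (simp add: size)
  qed
  have "card (Pow {1..m}) \<le>
      (2 ^ Suc l) ^ card {v \<in> e ` nodes. 1 \<le> pos v \<and> pos v \<le> 2 * t + 1}"
  proof (rule fooling_set_bound[OF lcp, where G = ?G and ident = "\<lambda>v. v" and inp = inp])
    fix a b :: "nat set" assume ab: "a \<in> Pow {1..m}" "b \<in> Pow {1..m}"
    show "pair_wf_digraph (?G a b)"
      using pair_graph_graph[of "wiring a b"]
      by (simp add: pair_graph_def pair_digraph_def pair_fin_digraph_def)
    show "id_assignment c (?G a b) (\<lambda>v. v)" by (rule id_assignment_id[OF c])
    show "(?G a b, inp) \<in> I" using inst ab by simp
    show "(?G a b, inp) \<notin> L \<or> (?G b a, inp) \<notin> L" if "a \<noteq> b"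
      using lang[of a b] lang[of b a] ab that by auto
    show "pos v \<le> pos u + 1 \<and> pos u \<le> pos v + 1" if "(u, v) \<in> parcs (?G a b)" for u v
      using that link_pos[of "wiring a b" "dec u" "dec v"] link_pos[of "wiring a b" "dec v" "dec u"]
      by (auto simp: parcs_graph adj_def pos_def)
    have L: "wiring a b False = wiring a a False" and R: "wiring a b True = wiring b b True"
      by (simp_all add: wiring_def)
    show "(u, v) \<in> parcs (?G a b) \<longleftrightarrow> (u, v) \<in> parcs (?G a a)"
      if "pos u \<le> 2 * t + 1" "pos v \<le> 2 * t + 1" for u v
    proof -
      have "layer_pos (dec u) \<le> Suc r" "layer_pos (dec v) \<le> Suc r"
        using that t unfolding pos_def by linarith+
      then have "adj (wiring a b) (dec u) (dec v) \<longleftrightarrow> adj (wiring a a) (dec u) (dec v)"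
        unfolding adj_def using link_left[of "wiring a b" "wiring a a", OF L] by blast
      then show ?thesis by (simp add: parcs_graph)
    qed
    show "(u, v) \<in> parcs (?G a b) \<longleftrightarrow> (u, v) \<in> parcs (?G b b)"
      if "1 \<le> pos u" "1 \<le> pos v" for u v
    proof -
      have "adj (wiring a b) (dec u) (dec v) \<longleftrightarrow> adj (wiring b b) (dec u) (dec v)"
        using that link_right[of "wiring a b" "wiring b b", OF R]
        unfolding adj_def pos_def by blast
      then show ?thesis by (simp add: parcs_graph)
    qed
  qed (use lang len finite_nodes in auto)
  also have "\<dots> \<le> (2 ^ Suc l) ^ (Suc r * B)"
    using card_middle by (intro power_increasing) (simp_all add: t)
  finally have "(2::nat) ^ m \<le> 2 ^ (Suc l * (Suc r * B))"
    by (simp only: card_Pow finite_atLeastAtMost card_atLeastAtMost diff_Suc_1 power_mult[symmetric])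
  then show ?thesis by (rule power_le_imp_le_exp[rotated]) simp
qed

lemma true_set:
  assumes "S \<subseteq> {1..m}"
  shows "{v \<in> e ` nodes. majority_dynamics (graph (wiring S S')) init M v} =
    e ` (clocks True True \<union> clocks False True \<union>
      (layers - (if S \<subseteq> S' then {} else Layer (Suc r) ` {..<3})))"
  (is "?A = e ` ?B")
proof -
  have "?A = e ` {u \<in> nodes. majority_dynamics (graph (wiring S S')) init M (e u)}" by blast
  also have "{u \<in> nodes. majority_dynamics (graph (wiring S S')) init M (e u)}
      = {u \<in> nodes. case u of Clock \<sigma> s i \<kappa> \<Rightarrow> s | Layer j \<kappa> \<Rightarrow> j = Suc r \<longrightarrow> S \<subseteq> S'}"
    using final_state[OF assms] by blast
  also have "\<dots> = ?B"
  proof (rule set_eqI)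
    fix u show "u \<in> {u \<in> nodes. case u of Clock \<sigma> s i \<kappa> \<Rightarrow> s | Layer j \<kappa> \<Rightarrow> j = Suc r \<longrightarrow> S \<subseteq> S'} \<longleftrightarrow> u \<in> ?B"
    proof (cases u)
      case (Clock \<sigma> s i \<kappa>)
      then show ?thesis
        by (cases \<sigma>; cases s) (auto simp: nodes_def block_iffs simp del: is_node.simps)
    next
      case (Layer j \<kappa>)
      then show ?thesis by (auto simp: nodes_def block_iffs width_def)
    qed
  qed
  finally show ?thesis .
qed

lemma card_true_set:
  assumes "S \<subseteq> {1..m}"
  shows "card {v \<in> e ` nodes. majority_dynamics (graph (wiring S S')) init M v} =
    K True True + K False True + 2 * (M * B) + layer_count - (if S \<subseteq> S' then 0 else 3)"
proof -
  let ?D = "if S \<subseteq> S' then {} else Layer (Suc r) ` {..<3}"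
  have D: "?D \<subseteq> layers" by (auto simp: layers_iff width_def)
  then have cD: "card (layers - ?D) = layer_count - (if S \<subseteq> S' then 0 else 3)"
    by (subst card_Diff_subset) (auto simp: card_layers intro: finite_subset)
  \<comment> \<open>This allows the truncated subtraction of 3 to be moved out of the sum.\<close>
  have "layer_count \<ge> 3" unfolding layer_count_def by (simp add: width_def)
  let ?B = "clocks True True \<union> clocks False True \<union> (layers - ?D)"
  have "?B \<subseteq> nodes" unfolding nodes_blocks by blast
  then have "card (e ` ?B) = card ?B" using e_inj by (meson card_image inj_on_subset)
  also have "\<dots> = card (clocks True True \<union> clocks False True) + card (layers - ?D)"
    using clocks_disjoint(3) by (intro card_Un_disjoint) (auto simp: finite_blocks)
  also have "\<dots> = K True True + K False True + 2 * (M * B) + (layer_count - (if S \<subseteq> S' then 0 else 3))"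
    unfolding cD by (simp add: card_Un_disjoint finite_blocks clocks_disjoint card_clocks)
  finally show ?thesis unfolding true_set[OF assms] using \<open>layer_count \<ge> 3\<close> by simp
qed

lemma election_bound:
  assumes "1 < c" "locally_checkable_proof c election_instances ELECTION_PREDICTION P t A" "r = 2 * t"
    and "certificate_size c ELECTION_PREDICTION P (card nodes) = enat l"
  shows "m \<le> Suc l * (Suc r * B)"
proof (rule certificate_bound[where inp = "\<lambda>v. (init v, M)", OF assms(1-3)])
  fix S S' assume S: "S \<subseteq> {1..m}" "S' \<subseteq> {1..m}"
  let ?G = "graph (wiring S S')"
  show "(?G, \<lambda>v. (init v, M)) \<in> election_instances"
    unfolding election_instances_def using simple_connected_graph M_ge by force
  have "(\<Sum>v\<in>pverts ?G. of_bool (majority_dynamics ?G init M v) :: real)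
      = real (card {v \<in> e ` nodes. majority_dynamics ?G init M v})"
    using finite_nodes by (simp add: of_bool_def sum.If_cases Int_def)
  then have maj: "(\<Sum>v\<in>pverts ?G. of_bool (majority_dynamics ?G init M v) :: real) > real (card (pverts ?G)) / 2
      \<longleftrightarrow> card nodes < 2 * card {v \<in> e ` nodes. majority_dynamics ?G init M v}"
    by simp linarith
  \<comment> \<open>Without alarm the ones exceed the zeros by between 1 and 6. An alarm turns three
    nodes and lowers this excess by 6, so it is no longer positive.\<close>
  have "\<dots> \<longleftrightarrow> S \<subseteq> S'"
    unfolding card_true_set[OF S(1)] card_nodes using balanced by auto
  then have iff: "(\<Sum>v\<in>pverts ?G. of_bool (majority_dynamics ?G init M v) :: real) > real (card (pverts ?G)) / 2
      \<longleftrightarrow> S \<subseteq> S'" using maj by blast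
  show "(?G, \<lambda>v. (init v, M)) \<in> ELECTION_PREDICTION \<longleftrightarrow> S \<subseteq> S'"
  proof
    assume "(?G, \<lambda>v. (init v, M)) \<in> ELECTION_PREDICTION"
    then obtain x T where "(\<lambda>v. (init v, M)) = (\<lambda>v. (x v, T))"
      and *: "(\<Sum>v\<in>pverts ?G. of_bool (majority_dynamics ?G x T v) :: real) > real (card (pverts ?G)) / 2"
      unfolding ELECTION_PREDICTION_def by blast
    then have "x = init" "T = M" by (auto simp: fun_eq_iff)
    then show "S \<subseteq> S'" using * iff by blast
  next
    assume "S \<subseteq> S'"
    then show "(?G, \<lambda>v. (init v, M)) \<in> ELECTION_PREDICTION"
      unfolding ELECTION_PREDICTION_def using iff simple_connected_graph M_ge by force
  qed
qed (rule assms)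

lemma reachability_bound:
  assumes "1 < c" "locally_checkable_proof c reachability_instances REACHABILITY P t A" "r = 2 * t"
    and "certificate_size c REACHABILITY P (card nodes) = enat l"
  shows "m \<le> Suc l * (Suc r * B)"
proof (rule certificate_bound[where inp = "\<lambda>v. (init v, final v, M)", OF assms(1-3)])
  fix S S' assume S: "S \<subseteq> {1..m}" "S' \<subseteq> {1..m}"
  let ?G = "graph (wiring S S')"
  show "(?G, \<lambda>v. (init v, final v, M)) \<in> reachability_instances"
    unfolding reachability_instances_def using simple_connected_graph M_ge by force
  have iff: "(\<forall>v\<in>pverts ?G. majority_dynamics ?G init M v = final v) \<longleftrightarrow> S \<subseteq> S'"
  proof
    assume "S \<subseteq> S'"
    then show "\<forall>v\<in>pverts ?G. majority_dynamics ?G init M v = final v"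
      using final_state[OF S(1)] by (auto simp: final_def split: node.splits)
  next
    assume all: "\<forall>v\<in>pverts ?G. majority_dynamics ?G init M v = final v"
    have "Layer (Suc r) 0 \<in> nodes" by (simp add: nodes_def width_def)
    then have "majority_dynamics ?G init M (e (Layer (Suc r) 0)) = final (e (Layer (Suc r) 0))"
      using all by simp
    then show "S \<subseteq> S'"
      using final_state[OF S(1) \<open>Layer (Suc r) 0 \<in> nodes\<close>, of S'] \<open>Layer (Suc r) 0 \<in> nodes\<close>
      by (simp add: final_def)
  qed
  show "(?G, \<lambda>v. (init v, final v, M)) \<in> REACHABILITY \<longleftrightarrow> S \<subseteq> S'"
  proof
    assume "(?G, \<lambda>v. (init v, final v, M)) \<in> REACHABILITY"
    then obtain x y T where "(\<lambda>v. (init v, final v, M)) = (\<lambda>v. (x v, y v, T))"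
      and *: "\<forall>v\<in>pverts ?G. majority_dynamics ?G x T v = y v"
      unfolding REACHABILITY_def by blast
    then have "x = init" "y = final" "T = M" by (auto simp: fun_eq_iff)
    then show "S \<subseteq> S'" using * iff by blast
  next
    assume "S \<subseteq> S'"
    then show "(?G, \<lambda>v. (init v, final v, M)) \<in> REACHABILITY"
      unfolding REACHABILITY_def using iff simple_connected_graph M_ge by force
  qed
qed (rule assms)

end

section \<open>The lower bound\<close>

text \<open>All sufficiently large \<open>n\<close> are needed, not only a sequence of sizes; the
  cliques take up the spare nodes.\<close>

lemma exists_network:
  fixes t :: nat
  assumes "1 \<le> t"
  shows "\<exists>N. \<forall>n\<ge>N. \<exists>M K e. disjointness_network (2 * t) M K e (n div (16 * (6 * t + 2))) \<and>
    card (clock_network.nodes (2 * t) M K) = n"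
proof -
  define r where "r = 2 * t"
  define b where "b = 3 * r + 2"
  define L where "L = clock_network.layer_count r"
  have r: "1 \<le> r" using assms by (simp add: r_def)
  have "\<exists>M K e. disjointness_network r M K e (n div (16 * b)) \<and> card (clock_network.nodes r M K) = n"
    if n: "16 * ((r + 3) * b) + 8 * b + 4 * L + 40 \<le> n" for n
  proof -
    define m where "m = n div (16 * b)"
    define M where "M = m + r + 3"
    have "16 * (m * b) \<le> n"
      using div_times_less_eq_dividend[of n "16 * b"] by (simp add: m_def algebra_simps)
    moreover have "M * b = m * b + (r + 3) * b" by (simp add: M_def algebra_simps)
    moreover have "8 * y + 4 * b + 2 * L + 20 \<le> n"
      if "16 * x \<le> n" "y = x + w" "16 * w + 8 * b + 4 * L + 40 \<le> n" for x y w
      using that by linarith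
    \<comment> \<open>The clock levels take \<open>4 * (M * b)\<close> nodes, and about as many must
      remain for each of the four cliques to exceed \<open>2 + Suc M * b\<close>. The factor 16 in
      \<open>m\<close> pays for both.\<close>
    ultimately have room: "8 * (M * b) + 4 * b + 2 * L + 20 \<le> n" using n by blast
    \<comment> \<open>The excess of ones at the end without alarm is \<open>4 - \<rho>\<close>; \<open>\<rho>\<close> accounts for the residue of \<open>n\<close> modulo 4.\<close>
    define \<rho> where "\<rho> = (n - (4 * (M * b) + L + (L - 4))) mod 4"
    define z where "z = (n - (4 * (M * b) + L + (L - 4))) div 4"
    have z: "n = 4 * (M * b) + L + (L - 4) + 4 * z + \<rho>" "\<rho> < 4"
      using room by (simp_all add: \<rho>_def z_def)
    \<comment> \<open>Bob's \<open>False\<close> clique, which stays 0, is enlarged to offset all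
      but four of the ones that the \<open>L\<close> channel and detector nodes contribute.\<close>
    define K where "K \<sigma> s = (if \<sigma> \<and> \<not> s then z + (L - 4) + \<rho> else z)" for \<sigma> s
    have "2 + Suc M * b < z" using z room by simp
    then have big: "2 + Suc M * b < K \<sigma> s" for \<sigma> s by (simp add: K_def)
    interpret net: clock_network r M K
      by unfold_locales (use r big in \<open>auto simp: M_def b_def\<close>)
    have "net.width 0 + net.width (Suc r) \<le> net.layer_count"
      unfolding net.layer_count_def by (simp add: sum.atMost_shift)
    then have L: "4 \<le> L" using r by (simp add: L_def net.width_def)
    have card: "card net.nodes = n"
      unfolding net.card_nodes L_def[symmetric] using z L by (simp add: K_def b_def)
    obtain e where e: "bij_betw e net.nodes {1..card net.nodes}"
      using finite_same_card_bij[of net.nodes "{1..card net.nodes}"] net.finite_nodes by auto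
    have "disjointness_network r M K e m"
      by unfold_locales (use e L z(2) in \<open>simp_all add: M_def K_def L_def[symmetric]\<close>)
    then show ?thesis using card unfolding m_def by blast
  qed
  moreover have "b = 6 * t + 2" by (simp add: b_def r_def)
  ultimately show ?thesis unfolding r_def by blast
qed

text \<open>The rounding in \<open>n div C\<close> and the successor in \<open>Suc l\<close>
  together cost at most \<open>2 * (C * q)\<close>, which is at most \<open>n / 2\<close> once
  \<open>n\<close> is at least \<open>4 * (C * q)\<close>; this yields the factor 2 in
  \<open>?k\<close>. An infinite value satisfies the bound trivially.\<close>

lemma bigomega_enat_linear:
  fixes f :: "nat \<Rightarrow> enat"
  assumes "0 < C" "0 < q" and bound: "\<And>n l. N \<le> n \<Longrightarrow> f n = enat l \<Longrightarrow> n div C \<le> Suc l * q"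
  shows "f \<in> bigomega_enat (\<lambda>n. real n)"
  unfolding bigomega_enat_def mem_Collect_eq
proof (intro exI conjI)
  let ?k = "1 / (2 * real C * real q)"
  show "0 < ?k" using assms(1,2) by simp
  show "\<forall>\<^sub>F n in sequentially. ereal (?k * real n) \<le> ereal_of_enat (f n)"
    using eventually_ge_at_top[of "max N (4 * (C * q))"]
  proof eventually_elim
    case (elim n)
    show ?case
    proof (cases "f n")
      case (enat l)
      have "n = C * (n div C) + n mod C" by simp
      also have "\<dots> < C * (n div C) + C" by (rule add_strict_left_mono) (use assms(1) in simp)
      also have "\<dots> \<le> C * (Suc l * q) + C" using bound[of n l] elim enat by simp
      also have "\<dots> \<le> l * (C * q) + 2 * (C * q)" using assms(2) by (simp add: algebra_simps)
      finally have "n \<le> 2 * (l * (C * q))" using elim by simp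
      then have "real n \<le> real l * (2 * real C * real q)"
        by (metis (mono_tags) mult.assoc mult.commute of_nat_le_iff of_nat_mult of_nat_numeral)
      then have "?k * real n \<le> real l" using assms(1,2) by (simp add: divide_le_eq)
      then show ?thesis using enat by simp
    qed simp
  qed
qed

theorem theorem4:
  fixes c :: real
  assumes "c > 1"
  shows "(\<forall>P t A. locally_checkable_proof c election_instances ELECTION_PREDICTION P t A \<longrightarrow>
            certificate_size c ELECTION_PREDICTION P \<in> bigomega_enat (\<lambda>n. real n)) \<and>
         (\<forall>P t A. locally_checkable_proof c reachability_instances REACHABILITY P t A \<longrightarrow>
            certificate_size c REACHABILITY P \<in> bigomega_enat (\<lambda>n. real n))"
proof (intro conjI allI impI)
  fix P t A
  assume lcp: "locally_checkable_proof c election_instances ELECTION_PREDICTION P t A"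
  then have "1 \<le> t" by (simp add: locally_checkable_proof_def)
  \<comment> \<open>The radius is constant, so \<open>N\<close>, the width of the cut and the ratio
    of \<open>n\<close> to \<open>m\<close> depend on \<open>t\<close> only.\<close>
  then obtain N where N: "\<forall>n\<ge>N. \<exists>M K e. disjointness_network (2 * t) M K e (n div (16 * (6 * t + 2))) \<and>
      card (clock_network.nodes (2 * t) M K) = n"
    using exists_network by blast
  show "certificate_size c ELECTION_PREDICTION P \<in> bigomega_enat (\<lambda>n. real n)"
  proof (rule bigomega_enat_linear)
    fix n l assume "N \<le> n" and size: "certificate_size c ELECTION_PREDICTION P n = enat l"
    obtain M K e where net: "disjointness_network (2 * t) M K e (n div (16 * (6 * t + 2)))"
      and card: "card (clock_network.nodes (2 * t) M K) = n"
      using N \<open>N \<le> n\<close> by blast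
    show "n div (16 * (6 * t + 2)) \<le> Suc l * (Suc (2 * t) * (3 * (2 * t) + 2))"
      by (rule disjointness_network.election_bound[OF net assms lcp refl size[folded card]])
  qed auto
next
  fix P t A
  assume lcp: "locally_checkable_proof c reachability_instances REACHABILITY P t A"
  then have "1 \<le> t" by (simp add: locally_checkable_proof_def)
  then obtain N where N: "\<forall>n\<ge>N. \<exists>M K e. disjointness_network (2 * t) M K e (n div (16 * (6 * t + 2))) \<and>
      card (clock_network.nodes (2 * t) M K) = n"
    using exists_network by blast
  show "certificate_size c REACHABILITY P \<in> bigomega_enat (\<lambda>n. real n)"
  proof (rule bigomega_enat_linear)
    fix n l assume "N \<le> n" and size: "certificate_size c REACHABILITY P n = enat l"
    obtain M K e where net: "disjointness_network (2 * t) M K e (n div (16 * (6 * t + 2)))"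
      and card: "card (clock_network.nodes (2 * t) M K) = n"
      using N \<open>N \<le> n\<close> by blast
    show "n div (16 * (6 * t + 2)) \<le> Suc l * (Suc (2 * t) * (3 * (2 * t) + 2))"
      by (rule disjointness_network.reachability_bound[OF net assms lcp refl size[folded card]])
  qed auto
qed

end
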